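(* Let $I$ be a composition of $n$. Then in $\mathbf{Sym}$, $$R_I=\sum_{J\vDash n} G_{IJ}\,L_J,$$ where $G_{IJ}$ is the number of permutations $\sigma\in\mathfrak S_n$ satisfying $\operatorname{D}(\sigma^{-1})=I$ and $\operatorname{GC}(\sigma)=J$. In particular, the $G_{IJ}$ are nonnegative integers.
   Context: $\mathbf{Sym}$ is the free associative algebra over a field $\mathbb{K}$ of characteristic zero on noncommuting generators $S_1,S_2,\dots$, $\deg S_n=n$, with $S_0=1$. For a composition $I=(i_1,\dots,i_r)$, $S^I=S_{i_1}\cdots S_{i_r}$, and the ribbon basis is $R_I=\sum_{J}(-1)^{l(I)-l(J)}S^J$, summed over compositions $J$ coarser than or equal to $I$ (obtained by summing consecutive parts of $I$); $l(\cdot)$ is the number of parts. The noncommutative power sums of the first kind $\Psi_n$ are defined by $nS_n=\sum_{k=0}^{n-1}S_k\Psi_{n-k}$. For a composition $(i_1,\dots,i_r)$ the noncommutative monomial functions $\Psi_{(i_1,\dots,i_r)}$ are defined recursively by $\Psi_{\emptyset}=1$, $\Psi_{(n)}=\Psi_n$ and $$r\,\Psi_{(i_1,\dots,i_r)}=\sum_{s=1}^{r}(-1)^{s-1}\Psi_{i_1+\dots+i_s}\,\Psi_{(i_{s+1},\dots,i_r)}$$ (equivalently, by a quasideterminant formula). Then $L_I=\sum_{J}\Psi_J$, summed over all compositions $J$ finer than or equal to $I$. For a permutation $\tau\in\mathfrak S_n$, $\operatorname{D}(\tau)$ is the composition of $n$ whose descent set (set of proper partial sums) is $\{i: \tau_i>\tau_{i+1}\}$.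 For $\sigma\in\mathfrak S_n$ as a word $\sigma_1\cdots\sigma_n$, $\operatorname{GDes}(\sigma)=\{\sigma_j: 1\le j<n,\ \sigma_j>\sigma_{j+1}\}$, and $\operatorname{GC}(\sigma)$ is the composition of $n$ whose set of proper partial sums is $\{d-1: d\in\operatorname{GDes}(\sigma)\}$. *)

theory Defs
  imports Complex_Main "HOL-Library.Poly_Mapping" "HOL-Combinatorics.Permutations"
begin

text \<open>
  The algebra \<open>Sym\<close> is the monoid algebra of the free monoid on the positive integers, the letter
  \<open>n\<close> standing for the generator \<open>S\<^sub>n\<close>.
\<close>

typedef sym_word = "{w :: nat list. 0 \<notin> set w}"
  morphisms letters Word
  by (rule exI[of _ "[]"]) simp

setup_lifting type_definition_sym_word

instantiation sym_word :: monoid_add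
begin

lift_definition zero_sym_word :: sym_word is "[]" by simp

lift_definition plus_sym_word :: "sym_word \<Rightarrow> sym_word \<Rightarrow> sym_word" is "(@)" by simp

instance by standard (transfer; simp)+

end

type_synonym 'k Sym = "sym_word \<Rightarrow>\<^sub>0 'k"

definition scalar :: "'k::field_char_0 \<Rightarrow> 'k Sym" where
  "scalar c = Poly_Mapping.single 0 c"

definition S :: "nat \<Rightarrow> 'k::field_char_0 Sym" where
  "S n = (if n = 0 then 1 else Poly_Mapping.single (Word [n]) 1)"

definition compositions :: "nat \<Rightarrow> nat list set" where
  "compositions n = {I. 0 \<notin> set I \<and> sum_list I = n}"

definition coarser_eq :: "nat list \<Rightarrow> nat list \<Rightarrow> bool" where
  "coarser_eq J I \<longleftrightarrow> (\<exists>B. [] \<notin> set B \<and> concat B = I \<and> J = map sum_list B)"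

definition S_comp :: "nat list \<Rightarrow> 'k::field_char_0 Sym" where
  "S_comp I = prod_list (map S I)"

definition ribbon :: "nat list \<Rightarrow> 'k::field_char_0 Sym" where
  "ribbon I = (\<Sum>J \<in> {J \<in> compositions (sum_list I). coarser_eq J I}.
     (-1) ^ (length I - length J) * S_comp J)"

text \<open>
  The defining relation \<open>n S\<^sub>n = (\<Sum>k<n. S\<^sub>k \<Psi>\<^bsub>n-k\<^esub>)\<close> solved for its term \<open>k = 0\<close>; see
  \<open>power_sum_relation\<close> below.
\<close>

fun power_sum :: "nat \<Rightarrow> 'k::field_char_0 Sym" where
  "power_sum n = of_nat n * S n - (\<Sum>k\<in>{1..<n}. S k * power_sum (n - k))"

declare power_sum.simps [simp del]

function Psi :: "nat list \<Rightarrow> 'k::field_char_0 Sym" where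
  "Psi I = (if I = [] then 1 else
     scalar (1 / of_nat (length I)) *
       (\<Sum>s\<in>{1..length I}. (-1) ^ (s - 1) * (power_sum (sum_list (take s I)) * Psi (drop s I))))"
  by auto
termination
  by (relation "measure length") auto

declare Psi.simps [simp del]

definition L :: "nat list \<Rightarrow> 'k::field_char_0 Sym" where
  "L I = (\<Sum>J \<in> {J \<in> compositions (sum_list I). coarser_eq I J}. Psi J)"

definition proper_partial_sums :: "nat list \<Rightarrow> nat set" where
  "proper_partial_sums I = {sum_list (take k I) | k. 0 < k \<and> k < length I}"

definition comp_of_set :: "nat \<Rightarrow> nat set \<Rightarrow> nat list" where
  "comp_of_set n A = (THE I. I \<in> compositions n \<and> proper_partial_sums I = A)"

text \<open>
  A permutation in \<open>\<SS>\<^sub>n\<close> is a function \<open>\<sigma>\<close> with \<open>\<sigma> permutes {1..n}\<close>; its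
  word is \<open>\<sigma> 1, \<dots>, \<sigma> n\<close>.
\<close>

definition D :: "nat \<Rightarrow> (nat \<Rightarrow> nat) \<Rightarrow> nat list" where
  "D n \<tau> = comp_of_set n {i. 1 \<le> i \<and> i < n \<and> \<tau> i > \<tau> (i + 1)}"

definition GDes :: "nat \<Rightarrow> (nat \<Rightarrow> nat) \<Rightarrow> nat set" where
  "GDes n \<sigma> = {\<sigma> j | j. 1 \<le> j \<and> j < n \<and> \<sigma> j > \<sigma> (j + 1)}"

definition GC :: "nat \<Rightarrow> (nat \<Rightarrow> nat) \<Rightarrow> nat list" where
  "GC n \<sigma> = comp_of_set n ((\<lambda>d. d - 1) ` GDes n \<sigma>)"

definition G :: "nat \<Rightarrow> nat list \<Rightarrow> nat list \<Rightarrow> nat" where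
  "G n I J = card {\<sigma>. \<sigma> permutes {1..n} \<and> D n (inv \<sigma>) = I \<and> GC n \<sigma> = J}"

lemma power_sum_relation:
  assumes "n \<ge> 1"
  shows "of_nat n * S n = (\<Sum>k<n. S k * (power_sum (n - k) :: 'k::field_char_0 Sym))"
proof -
  have "{..<n} = insert 0 {1..<n}" using assms by auto
  then show ?thesis
    by (simp add: power_sum.simps[of n] S_def[of 0])
qed

lemma of_nat_scalar: "(of_nat m :: 'k::field_char_0 Sym) = scalar (of_nat m)"
  by (simp add: scalar_def)

lemma scalar_mult: "scalar (a * b) = scalar a * scalar b"
  by (simp add: scalar_def mult_single)

lemma scalar_1: "scalar 1 = 1"
  by (simp add: scalar_def)

lemma Psi_Nil: "Psi [] = (1 :: 'k::field_char_0 Sym)"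
  by (simp add: Psi.simps)

lemma Psi_relation:
  assumes "I \<noteq> []"
  shows "of_nat (length I) * Psi I = (\<Sum>s\<in>{1..length I}. (-1) ^ (s - 1) *
    (power_sum (sum_list (take s I)) * (Psi (drop s I) :: 'k::field_char_0 Sym)))"
proof -
  have "(of_nat (length I) :: 'k Sym) * scalar (1 / of_nat (length I)) = 1"
    using assms by (simp add: of_nat_scalar scalar_mult[symmetric] scalar_1)
  then show ?thesis
    using assms by (simp add: Psi.simps[of I] mult.assoc[symmetric])
qed

lemma Psi_single:
  "Psi [n] = (power_sum n :: 'k::field_char_0 Sym)"
  using Psi_relation[of "[n]"] by (simp add: Psi_Nil)

lemma finite_compositions: "finite (compositions n)"
proof (rule finite_subset)
  show "compositions n \<subseteq> {xs. set xs \<subseteq> {..n} \<and> length xs \<le> n}"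
  proof
    fix xs assume "xs \<in> compositions n"
    then have p: "0 \<notin> set xs" and s: "sum_list xs = n" by (auto simp: compositions_def)
    have "length xs \<le> sum_list xs" using p by (induction xs) auto
    then show "xs \<in> {xs. set xs \<subseteq> {..n} \<and> length xs \<le> n}"
      using s member_le_sum_list by fastforce
  qed
  show "finite {xs. set xs \<subseteq> {..n} \<and> length xs \<le> n}"
    by (rule finite_lists_length_le) simp
qed

lemma proper_partial_sums_Nil: "proper_partial_sums [] = {}"
  by (simp add: proper_partial_sums_def)

lemma proper_partial_sums_Cons:
  "proper_partial_sums (i # I) = (if I = [] then {} else insert i ((+) i ` proper_partial_sums I))"
proof (cases "I = []")
  case True
  then show ?thesis by (auto simp: proper_partial_sums_def)
next
  case False
  have "proper_partial_sums (i # I) = {i + sum_list (take k I) | k. k < length I}" (is "?l = ?r")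
  proof (intro equalityI subsetI)
    fix x assume "x \<in> ?l"
    then obtain k where "0 < k" "k < length (i # I)" "x = sum_list (take k (i # I))"
      by (auto simp: proper_partial_sums_def)
    then show "x \<in> ?r" by (cases k) auto
  next
    fix x assume "x \<in> ?r"
    then obtain k where "k < length I" "x = i + sum_list (take k I)" by auto
    then show "x \<in> ?l"
      by (auto simp: proper_partial_sums_def intro!: exI[of _ "Suc k"])
  qed
  also have "\<dots> = insert i ((+) i ` proper_partial_sums I)" (is "_ = ?s")
  proof (intro equalityI subsetI)
    fix x assume "x \<in> ?r"
    then obtain k where k: "k < length I" "x = i + sum_list (take k I)" by auto
    then show "x \<in> ?s" by (cases "k = 0") (auto simp: proper_partial_sums_def)
  next
    fix x assume "x \<in> ?s"
    then show "x \<in> ?r"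
      using False by (auto simp: proper_partial_sums_def intro: exI[of _ 0])
  qed
  finally show ?thesis using False by simp
qed

lemma proper_partial_sums_pos: "0 \<notin> set I \<Longrightarrow> x \<in> proper_partial_sums I \<Longrightarrow> 0 < x"
  by (induction I arbitrary: x) (auto simp: proper_partial_sums_Nil proper_partial_sums_Cons split: if_splits)

lemma proper_partial_sums_inj:
  assumes "0 \<notin> set I" "0 \<notin> set J" "sum_list I = sum_list J"
    "proper_partial_sums I = proper_partial_sums J"
  shows "I = J"
  using assms
proof (induction I arbitrary: J)
  case Nil
  then show ?case by (cases J) auto
next
  case (Cons i I)
  then obtain j J' where J: "J = j # J'" by (cases J) auto
  show ?case
  proof (cases "I = [] \<or> J' = []")
    case True
    then show ?thesis using Cons.prems J by (auto simp: proper_partial_sums_Cons split: if_splits)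
  next
    case False
    have eq: "insert i ((+) i ` proper_partial_sums I) = insert j ((+) j ` proper_partial_sums J')"
      using Cons.prems(4) False by (simp add: J proper_partial_sums_Cons)
    have pI: "x > i" if "x \<in> (+) i ` proper_partial_sums I" for x
      using that Cons.prems(1) proper_partial_sums_pos[of I] by auto
    have pJ: "x > j" if "x \<in> (+) j ` proper_partial_sums J'" for x
      using that Cons.prems(2) J proper_partial_sums_pos[of J'] by auto
    have ij: "i = j" using eq pI pJ by (metis insertE insertI1 less_asym)
    then have "(+) i ` proper_partial_sums I = (+) i ` proper_partial_sums J'"
      using eq pI pJ by (metis insert_ident less_irrefl)
    then have "proper_partial_sums I = proper_partial_sums J'"
      by (simp add: inj_image_eq_iff)
    then show ?thesis using Cons.IH[of J'] Cons.prems J ij by simp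
  qed
qed

lemma proper_partial_sums_surj:
  assumes "A \<subseteq> {1..<n}"
  shows "\<exists>I\<in>compositions n. proper_partial_sums I = A"
  using assms
proof (induction n arbitrary: A rule: less_induct)
  case (less n)
  show ?case
  proof (cases "A = {}")
    case True
    show ?thesis
    proof (cases "n = 0")
      case False
      then show ?thesis using True
        by (intro bexI[of _ "[n]"]) (auto simp: compositions_def proper_partial_sums_def)
    next
      case n: True
      then show ?thesis using True
        by (intro bexI[of _ "[]"]) (auto simp: compositions_def proper_partial_sums_Nil)
    qed
  next
    case False
    define m where "m = Min A"
    have fin: "finite A" using less.prems finite_subset by blast
    have m: "m \<in> A" "\<And>a. a \<in> A \<Longrightarrow> m \<le> a" using fin False by (auto simp: m_def)
    then have mn: "0 < m" "m < n" using less.prems by auto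
    define A' where "A' = (\<lambda>a. a - m) ` (A - {m})"
    have "A' \<subseteq> {1..<n - m}"
      using m less.prems mn by (fastforce simp: A'_def)
    then obtain I where I: "I \<in> compositions (n - m)" "proper_partial_sums I = A'"
      using less.IH[of "n - m" A'] mn by auto
    have "I \<noteq> []" using I mn by (auto simp: compositions_def)
    moreover have "insert m ((+) m ` A') = A"
    proof -
      have "(+) m ` A' = (\<lambda>a. a) ` (A - {m})"
        unfolding A'_def image_image using m by (intro image_cong) auto
      then show ?thesis using m by auto
    qed
    ultimately have "proper_partial_sums (m # I) = A" using I by (simp add: proper_partial_sums_Cons)
    moreover have "m # I \<in> compositions n" using I mn by (auto simp: compositions_def)
    ultimately show ?thesis by blast
  qed
qed

lemma comp_of_set:
  assumes "A \<subseteq> {1..<n}"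
  shows "comp_of_set n A \<in> compositions n" "proper_partial_sums (comp_of_set n A) = A"
proof -
  have "\<exists>!I. I \<in> compositions n \<and> proper_partial_sums I = A"
    using proper_partial_sums_surj[OF assms]
    by (auto simp: compositions_def intro: proper_partial_sums_inj)
  from theI'[OF this] show "comp_of_set n A \<in> compositions n"
    "proper_partial_sums (comp_of_set n A) = A" by (simp_all add: comp_of_set_def)
qed

end

theory Submission
  imports Defs "HOL-Combinatorics.Multiset_Permutations"
begin

text \<open>
  Index compositions of \<open>n\<close> by subsets of \<open>{1..<n}\<close>. The recursion for \<open>\<Psi>\<close> gives
  \<open>\<Psi>\<^sub>a \<Psi>\<^bsub>K\<^esub> = (r + 1) \<Psi>\<^bsub>a\<cdot>K\<^esub> + r \<Psi>\<^bsub>a\<triangleright>K\<^esub>\<close> for \<open>r = l(K)\<close>, where \<open>a\<cdot>K\<close> prepends a part and \<open>a\<triangleright>K\<close>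
  adds \<open>a\<close> to the first part. Induction along \<open>i S\<^sub>i = (\<Sum>j<i. S\<^sub>j \<Psi>\<^bsub>i-j\<^esub>)\<close> then expands \<open>S\<^sub>i \<Psi>\<^bsub>K\<^esub>\<close>,
  and by Vandermonde's identity \<open>S\<^sub>i L\<^sub>B\<close> is the sum of \<open>(i choose card A) L\<^bsub>i + (B \<union> A)\<^esub>\<close> over
  \<open>A \<subseteq> {0..<m}\<close>. The same binomials count the shuffles of \<open>1 \<dots> i\<close> with a word \<open>\<tau>\<close> of size \<open>m\<close> shifted
  by \<open>i\<close>, according to the set of letters of \<open>\<tau>\<close> that are followed by a letter \<open>\<le> i\<close> and so become
  descent tops. Hence the sums \<open>T\<^bsub>K\<^esub>\<close> of \<open>L\<^bsub>GC \<sigma>\<^esub>\<close> over \<open>D(\<sigma>\<^sup>-\<^sup>1) = K\<close> satisfy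
  \<open>S\<^sub>i T\<^bsub>K\<^esub> = T\<^bsub>i\<cdot>K\<^esub> + T\<^bsub>i\<triangleright>K\<^esub>\<close>, which is the recursion that determines the ribbons.
\<close>

subsection \<open>Compositions and their descent sets\<close>

lemma proper_partial_sums_subset:
  assumes "I \<in> compositions n"
  shows "proper_partial_sums I \<subseteq> {1..<n}"
proof
  fix x assume "x \<in> proper_partial_sums I"
  then obtain k where k: "0 < k" "k < length I" "x = sum_list (take k I)"
    by (auto simp: proper_partial_sums_def)
  have I: "0 \<notin> set I" "sum_list I = n" using assms by (auto simp: compositions_def)
  have "drop k I = I ! k # drop (Suc k) I" using k by (simp add: Cons_nth_drop_Suc)
  moreover have "sum_list I = x + sum_list (drop k I)"
    using k by (metis append_take_drop_id sum_list_append)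
  moreover have "I ! k > 0" using I k by (metis gr0I nth_mem)
  ultimately have "x < n" using I by simp
  moreover have "0 < x"
    using proper_partial_sums_pos[OF I(1)] k by (auto simp: proper_partial_sums_def)
  ultimately show "x \<in> {1..<n}" by simp
qed

lemma comp_of_set_proper_partial_sums:
  assumes "I \<in> compositions n"
  shows "comp_of_set n (proper_partial_sums I) = I"
  using comp_of_set[OF proper_partial_sums_subset[OF assms]] assms
  by (auto simp: compositions_def intro: proper_partial_sums_inj)

lemma comp_of_set_eq_iff:
  assumes "I \<in> compositions n" "A \<subseteq> {1..<n}"
  shows "comp_of_set n A = I \<longleftrightarrow> A = proper_partial_sums I"
  using assms comp_of_set comp_of_set_proper_partial_sums by metis

lemma card_proper_partial_sums:
  "0 \<notin> set I \<Longrightarrow> card (proper_partial_sums I) = length I - 1"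
proof (induction I)
  case (Cons i I)
  have fin: "finite (proper_partial_sums I)"
    by (simp add: proper_partial_sums_def)
  have "i \<notin> (+) i ` proper_partial_sums I"
    using Cons.prems proper_partial_sums_pos[of I] by force
  then show ?case using Cons fin
    by (cases I) (auto simp: proper_partial_sums_Cons card_image)
qed (simp add: proper_partial_sums_Nil)

text \<open>Merging parts deletes partial sums: those of the block sums are the partial sums of the
  concatenation at block ends. Conversely, the inclusion says where to cut \<open>J\<close>, one
  block for each part of \<open>I\<close>.\<close>

lemma coarser_eq_iff:
  assumes "I \<in> compositions n" "J \<in> compositions n"
  shows "coarser_eq I J \<longleftrightarrow> proper_partial_sums I \<subseteq> proper_partial_sums J"
proof
  assume "coarser_eq I J"
  then obtain B where B: "[] \<notin> set B" "concat B = J" "I = map sum_list B"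
    by (auto simp: coarser_eq_def)
  show "proper_partial_sums I \<subseteq> proper_partial_sums J"
  proof
    fix x assume "x \<in> proper_partial_sums I"
    then obtain k where k: "0 < k" "k < length B" "x = sum_list (map sum_list (take k B))"
      by (auto simp: proper_partial_sums_def B take_map)
    define l where "l = length (concat (take k B))"
    have split: "J = concat (take k B) @ concat (drop k B)"
      using B(2) by (metis append_take_drop_id concat_append)
    have sum: "sum_list (map sum_list C) = sum_list (concat C)" for C :: "nat list list"
      by (induction C) auto
    \<comment> \<open>Nonempty blocks on both sides put the cut strictly inside
      \<open>J\<close>.\<close>
    have ne: "concat C \<noteq> []" if "C \<noteq> []" "set C \<subseteq> set B" for C
      using that B(1) by (cases C) auto
    have "take k B \<noteq> []" "drop k B \<noteq> []" using k by auto
    then have "concat (take k B) \<noteq> []" "concat (drop k B) \<noteq> []"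
      using ne set_take_subset set_drop_subset by metis+
    then have "0 < l" "l < length J" by (auto simp: l_def split)
    moreover have "x = sum_list (take l J)" using k by (simp add: split l_def sum)
    ultimately show "x \<in> proper_partial_sums J" by (auto simp: proper_partial_sums_def)
  qed
next
  assume "proper_partial_sums I \<subseteq> proper_partial_sums J"
  moreover have "0 \<notin> set I" "0 \<notin> set J" "sum_list I = sum_list J"
    using assms by (auto simp: compositions_def)
  ultimately show "coarser_eq I J"
  proof (induction I arbitrary: J)
    case Nil
    then show ?case by (cases J) (auto simp: coarser_eq_def intro: exI[of _ "[]"])
  next
    case (Cons i I)
    show ?case
    proof (cases "I = []")
      case True
      then show ?thesis using Cons.prems
        by (cases J) (auto simp: coarser_eq_def intro!: exI[of _ "[J]"])
    next
      case False
      then have "i \<in> proper_partial_sums J" using Cons.prems by (auto simp: proper_partial_sums_Cons)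
      \<comment> \<open>The first block is the prefix of \<open>J\<close> with sum \<open>i\<close>;
        the tail of \<open>I\<close> is then compared with the rest.\<close>
      then obtain k where k: "0 < k" "k < length J" "i = sum_list (take k J)"
        by (auto simp: proper_partial_sums_def)
      have sJ: "sum_list J = i + sum_list (drop k J)"
        using k by (metis append_take_drop_id sum_list_append)
      have "proper_partial_sums I \<subseteq> proper_partial_sums (drop k J)"
      proof
        fix x assume x: "x \<in> proper_partial_sums I"
        then have "i + x \<in> proper_partial_sums J" "x > 0"
          using Cons.prems False proper_partial_sums_pos[of I]
          by (auto simp: proper_partial_sums_Cons)
        then obtain l where l: "0 < l" "l < length J" "i + x = sum_list (take l J)"
          by (auto simp: proper_partial_sums_def)
        have "k < l"
        proof (rule ccontr)
          assume "\<not> k < l"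
          then have "take k J = take l J @ drop l (take k J)"
            by (metis append_take_drop_id min.absorb1 not_less take_take)
          then have "i \<ge> i + x" using k l by (metis le_add1 sum_list_append)
          then show False using \<open>x > 0\<close> by simp
        qed
        then have "take l J = take k J @ take (l - k) (drop k J)"
          by (metis less_imp_add_positive add_diff_cancel_left' take_add)
        then have "x = sum_list (take (l - k) (drop k J))" using k l by simp
        then show "x \<in> proper_partial_sums (drop k J)"
          using \<open>k < l\<close> l by (auto simp: proper_partial_sums_def intro!: exI[of _ "l - k"])
      qed
      moreover have "0 \<notin> set (drop k J)" using Cons.prems by (meson in_set_dropD)
      ultimately have "coarser_eq I (drop k J)" using Cons sJ by auto
      then obtain B where "[] \<notin> set B" "concat B = drop k J" "I = map sum_list B"
        by (auto simp: coarser_eq_def)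
      then show ?thesis using k by (auto simp: coarser_eq_def intro!: exI[of _ "take k J # B"])
    qed
  qed
qed

text \<open>For nonempty compositions, prepending a part \<open>a\<close> shifts the set of partial
  sums by \<open>a\<close> and inserts \<open>a\<close>, while adding \<open>a\<close> to the first
  part only shifts it. Sets \<open>E\<close> inside \<open>{1..<n}\<close> are meant.\<close>

definition Psi_set :: "nat \<Rightarrow> nat set \<Rightarrow> 'k::field_char_0 Sym" where
  "Psi_set n E = Psi (comp_of_set n E)"

definition L_set :: "nat \<Rightarrow> nat set \<Rightarrow> 'k::field_char_0 Sym" where
  "L_set n B = (\<Sum>E | B \<subseteq> E \<and> E \<subseteq> {1..<n}. Psi_set n E)"

lemma L_eq_L_set:
  assumes "I \<in> compositions n"
  shows "(L I :: 'k::field_char_0 Sym) = L_set n (proper_partial_sums I)"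
proof -
  have n: "sum_list I = n" using assms by (simp add: compositions_def)
  show ?thesis
    unfolding L_def L_set_def n
  proof (rule sum.reindex_bij_witness[of _ "comp_of_set n" proper_partial_sums])
    fix J assume "J \<in> {J \<in> compositions n. coarser_eq I J}"
    then have J: "J \<in> compositions n" "coarser_eq I J" by auto
    show "comp_of_set n (proper_partial_sums J) = J"
      using J(1) by (rule comp_of_set_proper_partial_sums)
    then show "Psi_set n (proper_partial_sums J) = Psi J" by (simp add: Psi_set_def)
    show "proper_partial_sums J \<in> {E. proper_partial_sums I \<subseteq> E \<and> E \<subseteq> {1..<n}}"
      using J assms coarser_eq_iff proper_partial_sums_subset by blast
  next
    fix E assume "E \<in> {E. proper_partial_sums I \<subseteq> E \<and> E \<subseteq> {1..<n}}"
    then show "proper_partial_sums (comp_of_set n E) = E"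
      "comp_of_set n E \<in> {J \<in> compositions n. coarser_eq I J}"
      using comp_of_set[of E n] assms by (auto simp: coarser_eq_iff)
  qed
qed

section \<open>Left multiplication of monomial functions by power sums\<close>

lemma proper_partial_sums_add_Cons:
  "proper_partial_sums ((a + k) # K) = (+) a ` proper_partial_sums (k # K)"
  by (auto simp: proper_partial_sums_Cons image_image add.assoc)

text \<open>The term \<open>s = 1\<close> of the recursion for \<open>a # k # K\<close> is the
  product on the left. Its term \<open>s + 1\<close> is the negative of term \<open>s\<close> for
  \<open>(a + k) # K\<close>, since the two prefixes have equal sums and the same parts
  remain.\<close>

lemma power_sum_mult_Psi_Cons:
  "power_sum a * (Psi (k # K) :: 'k::field_char_0 Sym) =
    of_nat (length K + 2) * Psi (a # k # K) + of_nat (length K + 1) * Psi ((a + k) # K)"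
proof -
  let ?t = "\<lambda>s. (-1) ^ (s - 1) * (power_sum (sum_list (take s ((a + k) # K))) *
      (Psi (drop s ((a + k) # K)) :: 'k Sym))"
  have 1: "of_nat (length K + 1) * (Psi ((a + k) # K) :: 'k Sym) = (\<Sum>s\<in>{1..length K + 1}. ?t s)"
    using Psi_relation[of "(a + k) # K"] by simp
  have "of_nat (length K + 2) * (Psi (a # k # K) :: 'k Sym) =
    (\<Sum>s\<in>{1..Suc (length K + 1)}. (-1) ^ (s - 1) * (power_sum (sum_list (take s (a # k # K))) *
      Psi (drop s (a # k # K))))"
    using Psi_relation[of "a # k # K"] by simp
  also have "\<dots> = power_sum a * Psi (k # K) +
    (\<Sum>s\<in>{1..length K + 1}. (-1) ^ s * (power_sum (sum_list (take (Suc s) (a # k # K))) *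
      Psi (drop (Suc s) (a # k # K))))"
    by (subst sum.atLeast_Suc_atMost) (simp_all add: sum.shift_bounds_cl_Suc_ivl del: sum.cl_ivl_Suc)
  also have "(\<Sum>s\<in>{1..length K + 1}. (-1) ^ s * (power_sum (sum_list (take (Suc s) (a # k # K))) *
      (Psi (drop (Suc s) (a # k # K)) :: 'k Sym))) = (\<Sum>s\<in>{1..length K + 1}. - ?t s)"
  proof (rule sum.cong)
    fix s assume "s \<in> {1..length K + 1}"
    then obtain r where "s = Suc r" by (cases s) auto
    then show "(-1) ^ s * (power_sum (sum_list (take (Suc s) (a # k # K))) *
      (Psi (drop (Suc s) (a # k # K)) :: 'k Sym)) = - ?t s" by (simp add: add.assoc)
  qed simp
  also have "\<dots> = - (of_nat (length K + 1) * Psi ((a + k) # K))"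
    by (simp only: 1 sum_negf)
  finally show ?thesis by simp
qed

text \<open>For \<open>m > 0\<close> the sum has two terms, with and without \<open>a\<close> in
  \<open>E\<close>; they are those of \<open>power_sum_mult_Psi_Cons\<close>, and
  \<open>card E + 1\<close> is the length of the composition. For \<open>m = 0\<close> the interval
  is empty and only \<open>Psi [a]\<close> remains.\<close>

lemma power_sum_mult_Psi_set:
  assumes "0 < a" "F \<subseteq> {1..<m}"
  shows "power_sum a * (Psi_set m F :: 'k::field_char_0 Sym) =
    (\<Sum>E | E \<subseteq> {a..<a + m} \<and> E \<inter> {a<..} = (+) a ` F. of_nat (card E + 1) * Psi_set (a + m) E)"
proof -
  define K where "K = comp_of_set m F"
  have K: "K \<in> compositions m" "proper_partial_sums K = F"
    using comp_of_set[OF assms(2)] by (auto simp: K_def)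
  show ?thesis
  proof (cases K)
    case Nil
    then have m: "m = 0" "F = {}" using K by (auto simp: compositions_def proper_partial_sums_Nil)
    have "comp_of_set a {} = [a]"
      using comp_of_set_proper_partial_sums[of "[a]" a] assms
      by (simp add: compositions_def proper_partial_sums_Cons)
    moreover have "{E. E \<subseteq> {a..<a + m} \<and> E \<inter> {a<..} = (+) a ` F} = {{}}" using m by auto
    moreover have "comp_of_set m F = []" using Nil by (simp add: K_def)
    ultimately show ?thesis using m by (simp add: Psi_set_def Psi_Nil Psi_single)
  next
    case (Cons k K')
    have k: "k > 0" "0 \<notin> set K'" "k + sum_list K' = m" using K Cons by (auto simp: compositions_def)
    let ?E = "(+) a ` F"
    have c: "comp_of_set (a + m) (insert a ?E) = a # k # K'"
      using comp_of_set_proper_partial_sums[of "a # k # K'" "a + m"] k assms K Cons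
      by (simp add: compositions_def proper_partial_sums_Cons[of a])
    have "proper_partial_sums ((a + k) # K') = ?E"
      using K Cons by (simp add: proper_partial_sums_add_Cons)
    then have d: "comp_of_set (a + m) ?E = (a + k) # K'"
      using comp_of_set_proper_partial_sums[of "(a + k) # K'" "a + m"] k assms
      by (simp add: compositions_def add.assoc)
    have a: "a \<notin> ?E" using assms by auto
    have fin: "finite F" using assms finite_subset by blast
    have "card F = length K'" using card_proper_partial_sums[of K] k K Cons by simp
    then have cards: "card ?E = length K'" "card (insert a ?E) = length K' + 1"
      using a fin by (auto simp: card_image)
    have "{E. E \<subseteq> {a..<a + m} \<and> E \<inter> {a<..} = ?E} = {insert a ?E, ?E}" (is "?X = _")
    proof (intro equalityI subsetI)
      fix E assume "E \<in> ?X"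
      then have E: "E \<subseteq> {a..<a + m}" "E \<inter> {a<..} = ?E" by auto
      have "x = a \<or> a < x" if "x \<in> E" for x using E(1) that by force
      then have "E = E \<inter> {a<..} \<or> E = insert a (E \<inter> {a<..})" by blast
      then show "E \<in> {insert a ?E, ?E}" unfolding E(2) by blast
    next
      fix E assume "E \<in> {insert a ?E, ?E}"
      then show "E \<in> ?X" using assms(2) k by fastforce
    qed
    moreover have "insert a ?E \<noteq> ?E" using a by auto
    ultimately show ?thesis
      using power_sum_mult_Psi_Cons[of a k K']
      by (simp add: Psi_set_def c d cards K_def[symmetric] Cons)
  qed
qed

subsection \<open>Left multiplication by complete functions\<close>

text \<open>A hockey-stick sum cut off at the largest element of \<open>E\<close> not exceeding
  \<open>i\<close>, if there is one. In the induction step, if \<open>Suc i\<close> is in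
  \<open>E\<close>, only \<open>j = Suc i\<close> survives and \<open>of_bool\<close> makes its term
  the whole right side; otherwise Pascal's rule adds the new term.\<close>

lemma sum_choose_gap:
  assumes "0 \<notin> E"
  shows "(\<Sum>j | j < Suc i \<and> E \<inter> {j<..<Suc i} = {}. (j + s + of_bool (j \<in> E)) choose j) =
    (Suc i + s) choose i"
proof (induction i)
  case 0
  have "{j. j < Suc 0 \<and> E \<inter> {j<..<Suc 0} = {}} = {0}" by auto
  then show ?case using assms by simp
next
  case (Suc i)
  show ?case
  proof (cases "Suc i \<in> E")
    case True
    then have "{j. j < Suc (Suc i) \<and> E \<inter> {j<..<Suc (Suc i)} = {}} = {Suc i}"
      by (force simp: less_Suc_eq)
    then show ?thesis using True by simp
  next
    case False
    have "{j<..<Suc (Suc i)} = insert (Suc i) {j<..<Suc i}" if "j < Suc i" for j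
      using that by auto
    then have "{j. j < Suc (Suc i) \<and> E \<inter> {j<..<Suc (Suc i)} = {}} =
        insert (Suc i) {j. j < Suc i \<and> E \<inter> {j<..<Suc i} = {}}"
      using False by (auto simp: less_Suc_eq)
    then show ?thesis using False Suc.IH by simp
  qed
qed

text \<open>This compares coefficients in \<open>S_mult_Psi_set\<close>: the term for
  \<open>j\<close> is the coefficient of \<open>Psi_set (i + m) E\<close> in the product of
  \<open>S j\<close>, \<open>power_sum (i - j)\<close> and \<open>Psi_set m F\<close>.\<close>

lemma weighted_sum_choose_gap:
  assumes "0 \<notin> E" "finite E"
  shows "(\<Sum>j | j < i \<and> E \<inter> {j<..<i} = {}.
      (card (E \<inter> {i..}) + 1) * ((j + card (E \<inter> {j..})) choose j)) =
    i * ((i + card (E \<inter> {i..})) choose i)"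
proof (cases i)
  case (Suc k)
  let ?s = "card (E \<inter> {i..})"
  \<comment> \<open>With no element strictly between \<open>j\<close> and \<open>i\<close>, the two
    tails of \<open>E\<close> differ at most by \<open>j\<close>.\<close>
  have "card (E \<inter> {j..}) = ?s + of_bool (j \<in> E)" if "j < i" "E \<inter> {j<..<i} = {}" for j
  proof -
    have "{j..} = insert j ({j<..<i} \<union> {i..})" using that by auto
    then have "E \<inter> {j..} = (if j \<in> E then insert j (E \<inter> {i..}) else E \<inter> {i..})"
      using that by auto
    then show ?thesis using that assms by simp
  qed
  then have "(\<Sum>j | j < i \<and> E \<inter> {j<..<i} = {}.
      (?s + 1) * ((j + card (E \<inter> {j..})) choose j)) =
    (?s + 1) * (\<Sum>j | j < i \<and> E \<inter> {j<..<i} = {}. (j + ?s + of_bool (j \<in> E)) choose j)"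
    by (simp add: sum_distrib_left add.assoc)
  also have "\<dots> = (?s + 1) * ((i + ?s) choose k)"
    using sum_choose_gap[OF assms(1), where i = k and s = ?s] Suc by simp
  \<comment> \<open>Absorption: the factor \<open>?s + 1\<close> raises the lower index
    \<open>k = i - 1\<close> to \<open>i\<close>.\<close>
  also have "\<dots> = i * ((i + ?s) choose i)"
    using binomial_absorb_comp[of "i + ?s" k] Suc
    by (metis Suc_times_binomial_add add.commute add_Suc_right plus_1_eq_Suc)
  finally show ?thesis .
qed simp

text \<open>In characteristic zero the scalar \<open>1 / of_nat i\<close> undoes the factor. This
  divides the relation between the \<open>S i\<close> and the power sums by
  \<open>i\<close>.\<close>

lemma of_nat_mult_cancel_Sym:
  fixes x y :: "'k::field_char_0 Sym"
  assumes "of_nat i * x = of_nat i * y" "i \<noteq> 0"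
  shows "x = y"
proof -
  have "scalar (1 / of_nat i) * (of_nat i * z) = z" for z :: "'k Sym"
    using assms(2)
    by (simp add: of_nat_scalar mult.assoc[symmetric] scalar_mult[symmetric] scalar_1)
  then show ?thesis using assms(1) by metis
qed

lemma of_nat_central: "x * (of_nat k * y) = of_nat k * (x * (y :: 'a::ring_1))"
  by (metis mult.assoc mult_of_nat_commute)

text \<open>On \<open>{i..}\<close> truncated subtraction loses nothing and inverts the shift. This
  describes the fibres of the maps used with \<open>sum.group\<close>.\<close>

lemma shift_image_eq_iff:
  fixes i :: nat
  assumes "A \<subseteq> {i..}"
  shows "(\<lambda>x. x - i) ` A = B \<longleftrightarrow> A = (+) i ` B"
proof
  assume "(\<lambda>x. x - i) ` A = B"
  moreover have "(+) i ` (\<lambda>x. x - i) ` A = (\<lambda>x. x) ` A"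
    unfolding image_image using assms by (intro image_cong) auto
  ultimately show "A = (+) i ` B" by simp
qed (simp add: image_image)

text \<open>Times \<open>i\<close>, the left side is the sum over \<open>j < i\<close> of the
  products of \<open>S j\<close>, \<open>power_sum (i - j)\<close> and \<open>Psi_set m F\<close>.
  There the power sum may insert \<open>i\<close> into \<open>E\<close>, and \<open>S j\<close>
  decides the elements up to \<open>j\<close>, so \<open>E\<close> has no element strictly between
  \<open>j\<close> and \<open>i\<close>. The coefficients add up by
  \<open>weighted_sum_choose_gap\<close>.\<close>

lemma S_mult_Psi_set:
  assumes "F \<subseteq> {1..<m}"
  shows "S i * (Psi_set m F :: 'k::field_char_0 Sym) =
    (\<Sum>E | E \<subseteq> {1..<i + m} \<and> E \<inter> {i<..} = (+) i ` F.
      of_nat ((i + card (E \<inter> {i..})) choose i) * Psi_set (i + m) E)"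
  using assms
proof (induction i arbitrary: m F rule: less_induct)
  case (less i)
  show ?case
  proof (cases "i = 0")
    case True
    have "{E. E \<subseteq> {1..<m} \<and> E \<inter> {0<..} = F} = {F}"
    proof (intro equalityI subsetI)
      fix E assume "E \<in> {E. E \<subseteq> {1..<m} \<and> E \<inter> {0<..} = F}"
      then have "E \<subseteq> {0<..}" "E \<inter> {0<..} = F" by auto
      then show "E \<in> {F}" by auto
    qed (use less.prems in auto)
    then show ?thesis using True by (simp add: S_def)
  next
    case False
    define X where "X = {E. E \<subseteq> {1..<i + m} \<and> E \<inter> {i<..} = (+) i ` F}"
    define c where "c = (\<lambda>E j. of_nat ((card (E \<inter> {i..}) + 1) * ((j + card (E \<inter> {j..})) choose j))
      * (Psi_set (i + m) E :: 'k Sym))"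
    have finX: "finite X"
      unfolding X_def by (rule finite_subset[of _ "Pow {1..<i + m}"]) auto
    have step: "S j * (power_sum (i - j) * (Psi_set m F :: 'k Sym)) =
        (\<Sum>E | E \<in> X \<and> E \<inter> {j<..<i} = {}. c E j)" if j: "j < i" for j
    proof -
      \<comment> \<open>\<open>Q\<close> indexes the expansion of the product with the power sum,
        and \<open>Y F'\<close> that of \<open>S j\<close> times the term of
        \<open>F'\<close>.\<close>
      define Q where "Q = {F'. F' \<subseteq> {i - j..<i - j + m} \<and> F' \<inter> {i - j<..} = (+) (i - j) ` F}"
      have finQ: "finite Q"
        unfolding Q_def by (rule finite_subset[of _ "Pow {i - j..<i - j + m}"]) auto
      have Q: "F' \<subseteq> {1..<i - j + m}" if "F' \<in> Q" for F'
        using that j by (fastforce simp: Q_def)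
      define Y where "Y = (\<lambda>F'. {E. E \<subseteq> {1..<i + m} \<and> E \<inter> {j<..} = (+) j ` F'})"
      \<comment> \<open>Each \<open>E\<close> arises from exactly one \<open>F'\<close>, recovered
        as the part of \<open>E\<close> above \<open>j\<close> shifted down; hence the double sum
        collapses by \<open>sum.group\<close>.\<close>
      let ?g = "\<lambda>E. (\<lambda>x. x - j) ` (E \<inter> {j<..})"
      have Ysub: "E \<in> X" "E \<inter> {j<..<i} = {}" "card F' = card (E \<inter> {i..})"
        if "F' \<in> Q" "E \<in> Y F'" for E F'
      proof -
        have E: "E \<subseteq> {1..<i + m}" "E \<inter> {j<..} = (+) j ` F'" using that by (auto simp: Y_def)
        have F': "F' \<subseteq> {i - j..}" "F' \<inter> {i - j<..} = (+) (i - j) ` F" using that by (auto simp: Q_def)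
        have "E \<inter> {i<..} = (E \<inter> {j<..}) \<inter> {i<..}" using j by auto
        also have "\<dots> = (+) j ` (F' \<inter> {i - j<..})" unfolding E using j by auto
        also have "\<dots> = (+) i ` F" unfolding F' using j by (auto simp: image_image)
        finally show "E \<in> X" using E by (auto simp: X_def)
        have "E \<inter> {j<..<i} = (E \<inter> {j<..}) \<inter> {..<i}" by auto
        also have "\<dots> = {}" unfolding E using F' by auto
        finally show "E \<inter> {j<..<i} = {}" .
        then have "E \<inter> {i..} = E \<inter> {j<..}" using j by force
        then show "card F' = card (E \<inter> {i..})" using E by (simp add: card_image)
      qed
      have g: "?g E \<in> Q" if "E \<in> X" "E \<inter> {j<..<i} = {}" for E
      proof -
        have E: "E \<subseteq> {1..<i + m}" "E \<inter> {i<..} = (+) i ` F" using that by (auto simp: X_def)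
        have "E \<inter> {j<..} \<subseteq> {i..<i+m}" using E that by force
        then have "?g E \<subseteq> {i - j..<i - j + m}" using j by force
        moreover have "?g E \<inter> {i - j<..} = (\<lambda>x. x - j) ` (E \<inter> {i<..})" using j by force
        moreover have "\<dots> = (+) (i - j) ` F" unfolding E using j by (auto simp: image_image)
        ultimately show ?thesis by (simp add: Q_def)
      qed
      have gY: "{E \<in> {E \<in> X. E \<inter> {j<..<i} = {}}. ?g E = F'} = Y F'" if "F' \<in> Q" for F'
      proof -
        have "?g E = F' \<longleftrightarrow> E \<inter> {j<..} = (+) j ` F'" for E
          by (rule shift_image_eq_iff) auto
        then have "E \<in> {E \<in> {E \<in> X. E \<inter> {j<..<i} = {}}. ?g E = F'} \<longleftrightarrow> E \<in> Y F'" for E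
          using Ysub(1,2)[OF that, of E] by (auto simp only: X_def Y_def mem_Collect_eq)
        then show ?thesis by (intro set_eqI)
      qed
      have "S j * (power_sum (i - j) * (Psi_set m F :: 'k Sym)) =
          (\<Sum>F'\<in>Q. of_nat (card F' + 1) * (S j * Psi_set (i - j + m) F'))"
        using j less.prems
        by (simp add: power_sum_mult_Psi_set Q_def sum_distrib_left of_nat_central del: of_nat_add of_nat_Suc)
      also have "\<dots> = (\<Sum>F'\<in>Q. \<Sum>E\<in>Y F'. c E j)"
      proof (rule sum.cong[OF refl])
        fix F' assume F': "F' \<in> Q"
        have "S j * (Psi_set (i - j + m) F' :: 'k Sym) =
          (\<Sum>E\<in>Y F'. of_nat ((j + card (E \<inter> {j..})) choose j) * Psi_set (i + m) E)"
          using less.IH[OF j Q[OF F']] j by (simp add: Y_def)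
        then show "of_nat (card F' + 1) * (S j * (Psi_set (i - j + m) F' :: 'k Sym)) = (\<Sum>E\<in>Y F'. c E j)"
          using Ysub(3)[OF F']
          by (simp add: sum_distrib_left c_def mult.assoc del: of_nat_add of_nat_Suc mult_Suc cong: sum.cong)
      qed
      also have "\<dots> = (\<Sum>F'\<in>Q. \<Sum>E\<in>{E \<in> {E \<in> X. E \<inter> {j<..<i} = {}}. ?g E = F'}. c E j)"
        using gY by (simp cong: sum.cong)
      also have "\<dots> = (\<Sum>E | E \<in> X \<and> E \<inter> {j<..<i} = {}. c E j)"
        using g finX finQ by (intro sum.group) auto
      finally show ?thesis .
    qed
    have "of_nat i * (S i * (Psi_set m F :: 'k Sym)) =
        (\<Sum>j<i. S j * (power_sum (i - j) * Psi_set m F))"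
      using power_sum_relation[of i, where 'k = 'k] False
      by (simp add: mult.assoc[symmetric] sum_distrib_right)
    also have "\<dots> = (\<Sum>j<i. \<Sum>E | E \<in> X \<and> E \<inter> {j<..<i} = {}. c E j)"
      using step by simp
    \<comment> \<open>Exchanging the sums leaves, for fixed \<open>E\<close>, the sum of
      \<open>weighted_sum_choose_gap\<close>.\<close>
    also have "\<dots> = (\<Sum>E\<in>X. \<Sum>j | j \<in> {..<i} \<and> E \<inter> {j<..<i} = {}. c E j)"
      using finX by (intro sum.swap_restrict) auto
    also have "\<dots> = (\<Sum>E\<in>X. of_nat (i * ((i + card (E \<inter> {i..})) choose i)) * Psi_set (i + m) E)"
    proof (rule sum.cong[OF refl])
      fix E assume "E \<in> X"
      then have "0 \<notin> E" "finite E" by (auto simp: X_def intro: finite_subset)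
      note w = weighted_sum_choose_gap[OF this, of i]
      show "(\<Sum>j | j \<in> {..<i} \<and> E \<inter> {j<..<i} = {}. c E j) =
          of_nat (i * ((i + card (E \<inter> {i..})) choose i)) * Psi_set (i + m) E"
        unfolding c_def sum_distrib_right[symmetric] of_nat_sum[symmetric] using w by simp
    qed
    also have "\<dots> = of_nat i *
        (\<Sum>E\<in>X. of_nat ((i + card (E \<inter> {i..})) choose i) * Psi_set (i + m) E)"
      by (simp add: sum_distrib_left mult.assoc)
    finally show ?thesis using False by (auto simp: X_def intro: of_nat_mult_cancel_Sym)
  qed
qed

text \<open>Vandermonde's identity. The offset \<open>k\<close> serves the induction: subsets
  containing the new element use \<open>Suc k\<close>, the others \<open>k\<close>, and Pascal's
  rule joins the two.\<close>

lemma sum_Pow_choose: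
  assumes "finite Y"
  shows "(\<Sum>X\<in>Pow Y. i choose (card X + k)) = (i + card Y) choose (card Y + k)"
  using assms
proof (induction Y arbitrary: i k rule: finite_induct)
  case (insert y Y)
  have "(\<Sum>X\<in>Pow (insert y Y). i choose (card X + k)) =
      (\<Sum>X\<in>Pow Y. i choose (card X + k)) + (\<Sum>X\<in>insert y ` Pow Y. i choose (card X + k))"
    unfolding Pow_insert using insert by (intro sum.union_disjoint) auto
  also have "(\<Sum>X\<in>insert y ` Pow Y. i choose (card X + k)) =
      (\<Sum>X\<in>Pow Y. i choose (card (insert y X) + k))"
  proof -
    have "inj_on (insert y) (Pow Y)"
      using insert.hyps by (intro inj_onI) (metis Pow_iff insert_ident subsetD)
    then show ?thesis by (simp add: sum.reindex)
  qed
  also have "\<dots> = (\<Sum>X\<in>Pow Y. i choose (card X + Suc k))"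
    using insert by (intro sum.cong) (auto simp: card_insert_if finite_subset)
  finally show ?case using insert.IH[of i k] insert.IH[of i "Suc k"] insert.hyps by simp
qed simp

text \<open>In the product each \<open>E\<close> containing the shift of \<open>B\<close> has
  coefficient \<open>(i + c) choose i\<close>, where \<open>c\<close> counts its elements from
  \<open>i\<close> on. By Vandermonde this is the sum of \<open>i choose card A\<close> over the
  \<open>A\<close> whose shift lies in \<open>E\<close>; for fixed \<open>A\<close> these
  \<open>E\<close> add up to an \<open>L_set\<close>. The element \<open>0\<close> of
  \<open>A\<close> stands for the partial sum \<open>i\<close>.\<close>

lemma S_mult_L_set:
  assumes "B \<subseteq> {1..<m}"
  shows "S i * (L_set m B :: 'k::field_char_0 Sym) =
    (\<Sum>A\<in>Pow {0..<m}. of_nat (i choose card A) * L_set (i + m) ((+) i ` (B \<union> A)))"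
proof -
  define X where "X = {E. (+) i ` B \<subseteq> E \<and> E \<subseteq> {1..<i + m}}"
  have finX: "finite X"
    unfolding X_def by (rule finite_subset[of _ "Pow {1..<i + m}"]) auto
  let ?g = "\<lambda>E. (\<lambda>x. x - i) ` (E \<inter> {i<..})"
  have g: "?g E = F \<longleftrightarrow> E \<inter> {i<..} = (+) i ` F" for E F
    by (rule shift_image_eq_iff) auto
  have "S i * (L_set m B :: 'k Sym) = (\<Sum>F | B \<subseteq> F \<and> F \<subseteq> {1..<m}. S i * Psi_set m F)"
    by (simp add: L_set_def sum_distrib_left)
  also have "\<dots> = (\<Sum>F | B \<subseteq> F \<and> F \<subseteq> {1..<m}. \<Sum>E | E \<in> X \<and> ?g E = F.
      of_nat ((i + card (E \<inter> {i..})) choose i) * Psi_set (i + m) E)"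
  proof (rule sum.cong[OF refl])
    fix F assume F: "F \<in> {F. B \<subseteq> F \<and> F \<subseteq> {1..<m}}"
    have "{E. E \<subseteq> {1..<i + m} \<and> E \<inter> {i<..} = (+) i ` F} = {E. E \<in> X \<and> ?g E = F}"
    proof -
      have "(+) i ` B \<subseteq> (+) i ` F" using F by auto
      then have "(+) i ` B \<subseteq> E" if "E \<inter> {i<..} = (+) i ` F" for E
        unfolding that[symmetric] by simp
      then show ?thesis unfolding g X_def by auto
    qed
    then show "S i * (Psi_set m F :: 'k Sym) = (\<Sum>E | E \<in> X \<and> ?g E = F.
      of_nat ((i + card (E \<inter> {i..})) choose i) * Psi_set (i + m) E)"
      using F by (simp add: S_mult_Psi_set)
  qed
  also have "\<dots> = (\<Sum>E\<in>X. of_nat ((i + card (E \<inter> {i..})) choose i) * Psi_set (i + m) E)"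
  proof (rule sum.group)
    show "finite X" by (fact finX)
    show "finite {F. B \<subseteq> F \<and> F \<subseteq> {1..<m}}"
      by (rule finite_subset[of _ "Pow {1..<m}"]) auto
    show "?g ` X \<subseteq> {F. B \<subseteq> F \<and> F \<subseteq> {1..<m}}"
    proof (rule image_subsetI, intro CollectI conjI)
      fix E assume E: "E \<in> X"
      show "B \<subseteq> ?g E"
      proof
        fix b assume "b \<in> B"
        then have "i + b \<in> E" "1 \<le> b" using E assms by (auto simp: X_def)
        then have "i + b \<in> E \<inter> {i<..}" by simp
        then show "b \<in> ?g E" by (metis add_diff_cancel_left' imageI)
      qed
      have "E \<inter> {i<..} \<subseteq> {i<..<i + m}" using E by (auto simp: X_def)
      then show "?g E \<subseteq> {1..<m}" by force
    qed
  qed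
  also have "\<dots> = (\<Sum>E\<in>X. \<Sum>A | A \<in> Pow {0..<m} \<and> (+) i ` A \<subseteq> E.
      of_nat (i choose card A) * Psi_set (i + m) E)"
  proof (rule sum.cong[OF refl])
    fix E assume "E \<in> X"
    then have E: "E \<subseteq> {1..<i + m}" by (simp add: X_def)
    have fin: "finite (E \<inter> {i..})" using E finite_subset by blast
    have "(\<Sum>A | A \<in> Pow {0..<m} \<and> (+) i ` A \<subseteq> E. i choose card A) =
        (\<Sum>Y\<in>Pow (E \<inter> {i..}). i choose card Y)"
    proof (rule sum.reindex_bij_witness[of _ "\<lambda>Y. (\<lambda>x. x - i) ` Y" "(`) ((+) i)"])
      fix Y assume "Y \<in> Pow (E \<inter> {i..})"
      then have Y: "Y \<subseteq> E" "Y \<subseteq> {i..}" by auto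
      show *: "(+) i ` (\<lambda>x. x - i) ` Y = Y"
        by (rule iffD1[OF shift_image_eq_iff[OF Y(2)] refl, symmetric])
      have "Y \<subseteq> {i..<i + m}" using Y E by force
      then have "(\<lambda>x. x - i) ` Y \<subseteq> {0..<m}" by force
      then show "(\<lambda>x. x - i) ` Y \<in> {A. A \<in> Pow {0..<m} \<and> (+) i ` A \<subseteq> E}"
        using Y * by simp
    qed (auto simp: image_image card_image)
    also have "\<dots> = (i + card (E \<inter> {i..})) choose i"
      using sum_Pow_choose[OF fin, of i 0] binomial_symmetric[of i "i + card (E \<inter> {i..})"] by simp
    finally have nat: "(\<Sum>A | A \<in> Pow {0..<m} \<and> (+) i ` A \<subseteq> E. i choose card A) =
        (i + card (E \<inter> {i..})) choose i" .
    show "of_nat ((i + card (E \<inter> {i..})) choose i) * Psi_set (i + m) E =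
        (\<Sum>A | A \<in> Pow {0..<m} \<and> (+) i ` A \<subseteq> E.
          of_nat (i choose card A) * (Psi_set (i + m) E :: 'k Sym))"
      unfolding nat[symmetric] of_nat_sum sum_distrib_right by (rule refl)
  qed
  also have "\<dots> = (\<Sum>A\<in>Pow {0..<m}. \<Sum>E | E \<in> X \<and> (+) i ` A \<subseteq> E.
      of_nat (i choose card A) * Psi_set (i + m) E)"
    using finX by (intro sum.swap_restrict) auto
  also have "\<dots> = (\<Sum>A\<in>Pow {0..<m}. of_nat (i choose card A) * L_set (i + m) ((+) i ` (B \<union> A)))"
  proof (rule sum.cong[OF refl])
    fix A
    have "{E. E \<in> X \<and> (+) i ` A \<subseteq> E} = {E. (+) i ` (B \<union> A) \<subseteq> E \<and> E \<subseteq> {1..<i + m}}"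
      unfolding X_def image_Un Un_subset_iff by blast
    then show "(\<Sum>E | E \<in> X \<and> (+) i ` A \<subseteq> E. of_nat (i choose card A) * Psi_set (i + m) E) =
        of_nat (i choose card A) * (L_set (i + m) ((+) i ` (B \<union> A)) :: 'k Sym)"
      by (simp only: L_set_def sum_distrib_left)
  qed
  finally show ?thesis .
qed

subsection \<open>Descent tops of shuffles\<close>

fun descent_tops :: "nat list \<Rightarrow> nat set" where
  "descent_tops [] = {}"
| "descent_tops [x] = {}"
| "descent_tops (x # y # ys) = (if x > y then insert x (descent_tops (y # ys)) else descent_tops (y # ys))"

lemma descent_tops_Cons:
  "descent_tops (x # ys) =
    (if ys \<noteq> [] \<and> x > hd ys then insert x (descent_tops ys) else descent_tops ys)"
  by (cases ys) auto

lemma descent_tops_subset: "descent_tops w \<subseteq> set w"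
  by (induction w rule: descent_tops.induct) auto

lemma descent_tops_sorted: "sorted_wrt (<) w \<Longrightarrow> descent_tops w = {}"
  by (induction w rule: descent_tops.induct) auto

lemma descent_tops_map_add: "descent_tops (map ((+) i) w) = (+) i ` descent_tops w"
  by (induction w rule: descent_tops.induct) auto

lemma descent_tops_gt: "x \<in> descent_tops w \<Longrightarrow> \<exists>y\<in>set w. y < x"
  by (induction w rule: descent_tops.induct) (auto split: if_splits)

text \<open>
  A letter of \<open>ys\<close> becomes a descent top as soon as a letter of \<open>xs\<close> is inserted right behind it,
  and letters of \<open>xs\<close> never do. There are \<open>length xs choose card A\<close> ways to cut \<open>xs\<close> into a possibly
  empty initial block and nonempty blocks behind the letters of \<open>A\<close>.
\<close>
lemma sum_shuffles_descent_tops: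
  fixes f :: "nat set \<Rightarrow> 'a::ring_1"
  assumes "sorted_wrt (<) xs" "distinct ys" "\<And>x y. x \<in> set xs \<Longrightarrow> y \<in> set ys \<Longrightarrow> x < y"
  shows "(\<Sum>w\<in>shuffles xs ys. f (descent_tops w)) =
    (\<Sum>A\<in>Pow (set ys). of_nat (length xs choose card A) * f (descent_tops ys \<union> A))"
  using assms
proof (induction ys arbitrary: xs f)
  case Nil
  then show ?case by (simp add: descent_tops_sorted)
next
  case (Cons y ys)
  note outer = Cons.IH
  have y: "y \<notin> set ys" "distinct ys" using Cons.prems by auto
  \<comment> \<open>The inner induction removes letters of \<open>xs\<close> with
    \<open>y # ys\<close> fixed; the outer hypothesis remains available for every \<open>xs\<close>
    and weight \<open>f\<close>.\<close>
  from Cons.prems(1,3) show ?case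
  proof (induction xs)
    case Nil
    have "(\<Sum>A\<in>Pow (set (y # ys)). of_nat (0 choose card A) * f (descent_tops (y # ys) \<union> A)) =
        (\<Sum>A\<in>{{}}. of_nat (0 choose card A) * f (descent_tops (y # ys) \<union> A))"
    proof (rule sum.mono_neutral_right)
      show "\<forall>A\<in>Pow (set (y # ys)) - {{}}. of_nat (0 choose card A) * f (descent_tops (y # ys) \<union> A) = 0"
      proof
        fix A assume A: "A \<in> Pow (set (y # ys)) - {{}}"
        then have "finite A" by (auto intro: finite_subset)
        then have "0 < card A" using A by (simp add: card_gt_0_iff)
        then show "of_nat (0 choose card A) * f (descent_tops (y # ys) \<union> A) = 0"
          by (simp add: binomial_eq_0)
      qed
    qed simp_all
    then show ?case by simp
  next
    case (Cons x xs)
    have xy: "x < y" and xys: "\<And>z. z \<in> set ys \<Longrightarrow> x < z" using Cons.prems by auto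
    have xxs: "\<And>z. z \<in> set xs \<Longrightarrow> x < z" and sxs: "sorted_wrt (<) xs" using Cons.prems by auto
    have lt: "\<And>a b. a \<in> set (x # xs) \<Longrightarrow> b \<in> set ys \<Longrightarrow> a < b" using Cons.prems by auto
    let ?T = "\<lambda>g xs ys. \<Sum>w\<in>shuffles xs ys. g (descent_tops w) :: 'a"
    \<comment> \<open>\<open>h\<close> is the weight when \<open>y\<close> keeps its right neighbour
      from \<open>ys\<close>, if any, and \<open>g\<close> the weight when \<open>x\<close> follows
      \<open>y\<close>.\<close>
    define h where "h = (\<lambda>X. f (if ys \<noteq> [] \<and> y > hd ys then insert y X else X))"
    define g where "g = (\<lambda>X. f (insert y X))"
    \<comment> \<open>\<open>x\<close> is smaller than all other letters, so at the front it is no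
      descent top.\<close>
    have top_x: "descent_tops (x # w) = descent_tops w" if "w \<in> shuffles xs zs" "\<forall>z\<in>set zs. x < z" for w zs
    proof -
      have "\<not> x > hd w" if "w \<noteq> []"
        using hd_in_set[OF that] set_shuffles[OF \<open>w \<in> shuffles xs zs\<close>] xxs \<open>\<forall>z\<in>set zs. x < z\<close>
        by fastforce
      then show ?thesis by (auto simp: descent_tops_Cons)
    qed
    have "?T f (x # xs) (y # ys) =
        (\<Sum>w\<in>shuffles xs (y # ys). f (descent_tops (x # w))) +
        (\<Sum>w\<in>shuffles (x # xs) ys. f (descent_tops (y # w)))"
      using xy by (subst shuffles.simps, subst sum.union_disjoint) (auto simp: sum.reindex)
    also have "(\<Sum>w\<in>shuffles xs (y # ys). f (descent_tops (x # w))) = ?T f xs (y # ys)"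
      using top_x[of _ "y # ys"] xy xys by (intro sum.cong) auto
    also have "(\<Sum>w\<in>shuffles (x # xs) ys. f (descent_tops (y # w))) =
        ?T h (x # xs) ys + (?T g xs ys - ?T h xs ys)"
    proof -
      \<comment> \<open>A shuffle of \<open>x # xs\<close> and \<open>ys\<close> starts with
        \<open>x\<close> or with the head of \<open>ys\<close>. The weight \<open>h\<close> is wrong
        only in the first case, where \<open>g - h\<close> corrects it.\<close>
      let ?P = "\<lambda>w. hd w = x"
      have starts: "{w \<in> shuffles (x # xs) ys. ?P w} = (#) x ` shuffles xs ys"
      proof (intro equalityI subsetI)
        fix w assume w: "w \<in> {w \<in> shuffles (x # xs) ys. ?P w}"
        then have "w \<noteq> []" by auto
        then obtain w' where w': "w = x # w'" using w by (cases w) auto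
        have "ys = [] \<or> hd ys \<noteq> x" using xys by (cases ys) auto
        then show "w \<in> (#) x ` shuffles xs ys" using w by (auto simp: w' Cons_in_shuffles_iff)
      qed (auto simp: Cons_in_shuffles_iff)
      have "f (descent_tops (y # w)) = h (descent_tops w) +
          (if ?P w then g (descent_tops w) - h (descent_tops w) else 0)"
        if w: "w \<in> shuffles (x # xs) ys" for w
      proof (cases "?P w")
        case True
        moreover have "w \<noteq> []" using w by auto
        ultimately show ?thesis using xy by (simp add: descent_tops_Cons[of y] g_def)
      next
        case False
        moreover obtain z w' where z: "w = z # w'" using w by (cases w) auto
        ultimately have "ys \<noteq> []" "hd ys = z" using w by (auto simp: Cons_in_shuffles_iff)
        then show ?thesis using False z by (simp add: h_def)
      qed
      then have "(\<Sum>w\<in>shuffles (x # xs) ys. f (descent_tops (y # w))) = ?T h (x # xs) ys +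
          (\<Sum>w\<in>shuffles (x # xs) ys. if ?P w then g (descent_tops w) - h (descent_tops w) else 0)"
        by (simp add: sum.distrib)
      also have "(\<Sum>w\<in>shuffles (x # xs) ys. if ?P w then g (descent_tops w) - h (descent_tops w) else 0) =
          (\<Sum>w\<in>(#) x ` shuffles xs ys. g (descent_tops w) - h (descent_tops w))"
        by (simp add: starts[symmetric] sum.inter_filter)
      also have "\<dots> = (\<Sum>w\<in>shuffles xs ys. g (descent_tops w) - h (descent_tops w))"
        using top_x[of _ ys] xys by (simp add: sum.reindex)
      finally show ?thesis by (simp add: sum_subtractf)
    qed
    finally have lhs: "?T f (x # xs) (y # ys) =
        ?T f xs (y # ys) + (?T h (x # xs) ys + (?T g xs ys - ?T h xs ys))" .
    define k where "k = length xs"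
    let ?D = "descent_tops ys"
    have h_eq: "f (descent_tops (y # ys) \<union> A) = h (?D \<union> A)" for A
      by (simp add: h_def descent_tops_Cons)
    have g_eq: "h (?D \<union> insert y A) = g (?D \<union> A)" for A
      by (simp add: g_def h_def)
    have split: "(\<Sum>A\<in>Pow (set (y # ys)). of_nat (l choose card A) * f (descent_tops (y # ys) \<union> A)) =
        (\<Sum>A\<in>Pow (set ys). of_nat (l choose card A) * h (?D \<union> A)) +
        (\<Sum>A\<in>Pow (set ys). of_nat (l choose Suc (card A)) * g (?D \<union> A))" for l
    proof -
      have "inj_on (insert y) (Pow (set ys))"
        using y by (intro inj_onI) (metis Pow_iff insert_ident subsetD)
      moreover have "card (insert y A) = Suc (card A)" if "A \<subseteq> set ys" for A
        using that y finite_subset[OF that] by (auto simp: card_insert_if)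
      ultimately show ?thesis
        unfolding list.set Pow_insert using y
        by (subst sum.union_disjoint) (auto simp: sum.reindex h_eq g_eq simp del: Un_insert_right)
    qed
    have T: "?T F xs ys = (\<Sum>A\<in>Pow (set ys). of_nat (k choose card A) * F (?D \<union> A))" for F
      unfolding k_def using outer[OF sxs y(2)] lt by simp
    have T': "?T F (x # xs) ys = (\<Sum>A\<in>Pow (set ys). of_nat (Suc k choose card A) * F (?D \<union> A))" for F
      unfolding k_def using outer[OF Cons.prems(1) y(2)] lt by simp
    have inner: "?T f xs (y # ys) =
        (\<Sum>A\<in>Pow (set ys). of_nat (k choose card A) * h (?D \<union> A)) +
        (\<Sum>A\<in>Pow (set ys). of_nat (k choose Suc (card A)) * g (?D \<union> A))"
      unfolding k_def split[symmetric] using Cons.IH[OF sxs] Cons.prems by auto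
    \<comment> \<open>In the coefficients of \<open>h\<close> the contribution of
      \<open>?T h xs ys\<close> cancels and \<open>Suc k choose card A\<close> remains; those of
      \<open>g\<close> combine by Pascal's rule.\<close>
    show ?case
      unfolding lhs inner T T' list.size(4) k_def[symmetric] One_nat_def add_Suc_right add_0_right split
      by (simp add: distrib_right sum.distrib)
  qed
qed

subsection \<open>Words with prescribed inverse descents\<close>

text \<open>
  \<open>inverse_descents w\<close> is the descent set of the inverse of the permutation with word \<open>w\<close>:
  the letter \<open>d + 1\<close> occurs before the letter \<open>d\<close>.
\<close>
definition inverse_descents :: "nat list \<Rightarrow> nat set" where
  "inverse_descents w = {d. filter (\<lambda>x. x = d \<or> x = Suc d) w = [Suc d, d]}"

lemma inverse_descents_letters:
  assumes "d \<in> inverse_descents w"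
  shows "d \<in> set w" "Suc d \<in> set w"
proof -
  have "set (filter (\<lambda>x. x = d \<or> x = Suc d) w) = {Suc d, d}"
    using assms by (simp add: inverse_descents_def)
  then show "d \<in> set w" "Suc d \<in> set w" by auto
qed

lemma inverse_descents_subset:
  assumes "set w = {1..n}"
  shows "inverse_descents w \<subseteq> {1..<n}"
  using inverse_descents_letters[of _ w] assms by fastforce

lemma inverse_descents_sorted: "sorted_wrt (<) w \<Longrightarrow> inverse_descents w = {}"
proof -
  assume "sorted_wrt (<) w"
  then have "sorted_wrt (<) (filter P w)" for P by (rule sorted_wrt_filter)
  then have "filter P w \<noteq> [Suc d, d]" for P d
    by (metis Suc_n_not_le_n less_imp_le sorted_wrt2_simps sorted_wrt.simps(2) list.set_intros(1))
  then show ?thesis by (simp add: inverse_descents_def)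
qed

lemma inverse_descents_map_add:
  "inverse_descents (map ((+) i) w) = (+) i ` inverse_descents w"
proof (intro equalityI subsetI)
  fix d assume d: "d \<in> inverse_descents (map ((+) i) w)"
  then obtain e where e: "d = i + e" using inverse_descents_letters[OF d] by auto
  then have "map ((+) i) (filter (\<lambda>x. x = e \<or> x = Suc e) w) = map ((+) i) [Suc e, e]"
    using d by (simp add: inverse_descents_def filter_map o_def flip: add_Suc_right)
  then have "filter (\<lambda>x. x = e \<or> x = Suc e) w = [Suc e, e]"
    by (subst (asm) inj_map_eq_map) auto
  then show "d \<in> (+) i ` inverse_descents w" using e by (simp add: inverse_descents_def)
qed (auto simp: inverse_descents_def filter_map o_def simp flip: add_Suc_right)

lemma inverse_descents_filter:
  assumes "P d" "P (Suc d)"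
  shows "d \<in> inverse_descents (filter P w) \<longleftrightarrow> d \<in> inverse_descents w"
proof -
  have "filter (\<lambda>x. x = d \<or> x = Suc d) (filter P w) = filter (\<lambda>x. x = d \<or> x = Suc d) w"
    unfolding filter_filter using assms by (intro filter_cong) auto
  then show ?thesis by (simp add: inverse_descents_def)
qed

text \<open>The letters \<open>d\<close> and \<open>Suc d\<close> lie on the same side of the cut
  after \<open>i\<close> unless \<open>d = i\<close>, and neither side contains both
  \<open>i\<close> and \<open>Suc i\<close>.\<close>

lemma inverse_descents_split:
  "inverse_descents w - {i} =
    inverse_descents (filter (\<lambda>x. x \<le> i) w) \<union> inverse_descents (filter (\<lambda>x. \<not> x \<le> i) w)"
  (is "_ = inverse_descents ?u \<union> inverse_descents ?v")
proof (intro equalityI subsetI)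
  fix d assume d: "d \<in> inverse_descents w - {i}"
  then have "d < i \<or> d > i" by auto
  then show "d \<in> inverse_descents ?u \<union> inverse_descents ?v"
    using d by (auto simp: inverse_descents_filter)
next
  fix d assume "d \<in> inverse_descents ?u \<union> inverse_descents ?v"
  then show "d \<in> inverse_descents w - {i}"
  proof
    assume d: "d \<in> inverse_descents ?u"
    then have "Suc d \<le> i" using inverse_descents_letters[OF d] by auto
    then show ?thesis using d by (auto simp: inverse_descents_filter)
  next
    assume d: "d \<in> inverse_descents ?v"
    then have "i < d" using inverse_descents_letters[OF d] by auto
    then show ?thesis using d by (auto simp: inverse_descents_filter)
  qed
qed

text \<open>Deleting the largest letter leaves the increasing word by induction. If anything
  followed the largest letter, the last letter would be the second largest, giving an inverse
  descent.\<close>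

lemma inverse_descents_empty_imp:
  assumes "distinct u" "set u = {1..i}" "inverse_descents u = {}"
  shows "u = [1..<Suc i]"
  using assms
proof (induction i arbitrary: u)
  case (Suc i)
  define u' where "u' = filter (\<lambda>x. x \<le> i) u"
  have "set u' = {1..i}" using Suc.prems(2) by (auto simp: u'_def)
  moreover have "inverse_descents u' = {}"
    using inverse_descents_split[of u i] Suc.prems(3) by (auto simp: u'_def)
  ultimately have u': "u' = [1..<Suc i]" using Suc.IH Suc.prems(1) by (simp add: u'_def)
  have "Suc i \<in> set u" using Suc.prems by simp
  then obtain us vs where u: "u = us @ Suc i # vs" by (meson split_list)
  have in_i: "x \<le> i" if "x \<in> set us \<union> set vs" for x
  proof -
    have "x \<in> set u" "x \<noteq> Suc i" using that Suc.prems(1) u by auto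
    then show ?thesis using Suc.prems(2) by auto
  qed
  then have u'_split: "u' = us @ vs" by (simp add: u'_def u)
  have "vs = []"
  proof (rule ccontr)
    assume "vs \<noteq> []"
    then obtain vs' z where vs: "vs = vs' @ [z]" by (metis append_butlast_last_id)
    have "us @ vs' @ [z] = [1..<Suc i]" using u' u'_split vs by simp
    then have z: "i \<noteq> 0 \<and> z = i" by (cases i) auto
    have "i \<notin> set us \<union> set vs'" using Suc.prems(1) z u vs by auto
    then have "filter (\<lambda>x. x = i \<or> x = Suc i) us = []" "filter (\<lambda>x. x = i \<or> x = Suc i) vs' = []"
      using in_i vs by (fastforce simp: filter_empty_conv)+
    then have "i \<in> inverse_descents u" using z by (simp add: inverse_descents_def u vs)
    then show False using Suc.prems(3) by simp
  qed
  then show ?case using u u' u'_split by simp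
qed simp

definition words :: "nat \<Rightarrow> nat set \<Rightarrow> nat list set" where
  "words n E = {w \<in> permutations_of_set {1..n}. inverse_descents w = E}"

lemma finite_words: "finite (words n E)"
  by (simp add: words_def)

lemma words_iff: "w \<in> words n E \<longleftrightarrow> distinct w \<and> set w = {1..n} \<and> inverse_descents w = E"
  by (auto simp: words_def permutations_of_set_def)

text \<open>By \<open>inverse_descents_split\<close> the letters up to \<open>i\<close> have no
  inverse descents and so stand in increasing order, while the larger ones form the shift of
  \<open>v\<close>. Disregarding the inverse descent \<open>i\<close> leaves the relative order of
  \<open>i\<close> and \<open>Suc i\<close> free.\<close>

lemma words_shuffle:
  assumes "E \<subseteq> {1..<m}" "v \<in> words m E"
  shows "{w. distinct w \<and> set w = {1..i + m} \<and> inverse_descents w - {i} = (+) i ` E \<and>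
      map (\<lambda>x. x - i) (filter (\<lambda>x. \<not> x \<le> i) w) = v} =
    shuffles [1..<Suc i] (map ((+) i) v)" (is "?X = ?Y")
proof (intro equalityI subsetI)
  fix w assume "w \<in> ?X"
  then have w: "distinct w" "set w = {1..i + m}" "inverse_descents w - {i} = (+) i ` E"
    "map (\<lambda>x. x - i) (filter (\<lambda>x. \<not> x \<le> i) w) = v" by auto
  have "map ((+) i) v = map (\<lambda>x. x) (filter (\<lambda>x. \<not> x \<le> i) w)"
    unfolding w(4)[symmetric] map_map by (intro map_cong) auto
  then have v: "filter (\<lambda>x. \<not> x \<le> i) w = map ((+) i) v" by simp
  \<comment> \<open>Such a \<open>d\<close> would be below \<open>i\<close> by its letters and above
    \<open>i\<close> as an element of the shift of \<open>E\<close>.\<close>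
  have "inverse_descents (filter (\<lambda>x. x \<le> i) w) = {}"
  proof -
    have "d < i" if "d \<in> inverse_descents (filter (\<lambda>x. x \<le> i) w)" for d
      using inverse_descents_letters[OF that] by auto
    moreover have "i < d" if "d \<in> inverse_descents (filter (\<lambda>x. x \<le> i) w)" for d
    proof -
      have "d \<in> (+) i ` E" using that w(3) inverse_descents_split[of w i] by auto
      then show ?thesis using assms(1) by auto
    qed
    ultimately show ?thesis by fastforce
  qed
  moreover have "set (filter (\<lambda>x. x \<le> i) w) = {1..i}" using w(2) by auto
  ultimately have "filter (\<lambda>x. x \<le> i) w = [1..<Suc i]"
    using w(1) by (intro inverse_descents_empty_imp) auto
  then show "w \<in> ?Y" using partition_in_shuffles[of w "\<lambda>x. x \<le> i"] v by simp
next
  fix w assume w: "w \<in> ?Y"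
  have v: "distinct v" "set v = {1..m}" "inverse_descents v = E" using assms by (auto simp: words_iff)
  have u: "set [1..<Suc i] = {1..i}" by auto
  have u': "set (map ((+) i) v) = {i + 1..i + m}" using v by (simp add: image_add_atLeastAtMost)
  have disj: "set [1..<Suc i] \<inter> set (map ((+) i) v) = {}" unfolding u u' by auto
  have set: "set w = {1..i} \<union> {i + 1..i + m}" using set_shuffles[OF w] unfolding u u' .
  have f1: "filter (\<lambda>x. x \<le> i) w = [1..<Suc i]"
  proof -
    have "filter (\<lambda>x. x \<le> i) w = filter (\<lambda>x. x \<in> set [1..<Suc i]) w"
      using set by (intro filter_cong) auto
    then show ?thesis using filter_shuffles_disjoint1(1)[OF disj w] by simp
  qed
  have f2: "filter (\<lambda>x. \<not> x \<le> i) w = map ((+) i) v"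
  proof -
    have "filter (\<lambda>x. \<not> x \<le> i) w = filter (\<lambda>x. x \<notin> set [1..<Suc i]) w"
      using set by (intro filter_cong) auto
    then show ?thesis using filter_shuffles_disjoint1(2)[OF disj w] by simp
  qed
  have "inverse_descents w - {i} = (+) i ` E"
    unfolding inverse_descents_split f1 f2 inverse_descents_map_add v
    by (simp add: inverse_descents_sorted del: upt_Suc)
  moreover have "distinct w"
    by (rule distinct_disjoint_shuffles[OF _ _ disj w]) (use v in \<open>auto simp: distinct_map\<close>)
  moreover have "set w = {1..i + m}" unfolding set by auto
  ultimately show "w \<in> ?X" using f2 by (simp add: o_def)
qed

text \<open>For the word of \<open>\<sigma>\<close> this is the set of proper partial sums of
  \<open>GC n \<sigma>\<close>.\<close>

definition shifted_tops :: "nat list \<Rightarrow> nat set" where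
  "shifted_tops w = (\<lambda>d. d - 1) ` descent_tops w"

text \<open>A descent top exceeds another letter, hence is at least 2.\<close>

lemma shifted_tops_subset:
  assumes "set w = {1..n}"
  shows "shifted_tops w \<subseteq> {1..<n}"
proof
  fix x assume "x \<in> shifted_tops w"
  then obtain d where d: "d \<in> descent_tops w" "x = d - 1" by (auto simp: shifted_tops_def)
  then obtain y where "y \<in> set w" "y < d" using descent_tops_gt by blast
  moreover have "d \<in> set w" using d descent_tops_subset by blast
  ultimately show "x \<in> {1..<n}" using d assms by auto
qed

text \<open>The sums \<open>T\<close> of the overview, taken over words and not yet grouped by the
  value of \<open>GC\<close>.\<close>

definition L_sum :: "nat \<Rightarrow> nat set \<Rightarrow> 'k::field_char_0 Sym" where
  "L_sum n E = (\<Sum>w\<in>words n E. L_set n (shifted_tops w))"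

text \<open>\<open>S_mult_L_set\<close> and \<open>sum_shuffles_descent_tops\<close> both give sums
  over subsets \<open>A\<close> weighted by \<open>i choose card A\<close>; the index sets differ by
  a shift.\<close>

lemma S_mult_L_set_shifted_tops:
  assumes "distinct v" "set v = {1..m}"
  shows "S i * (L_set m (shifted_tops v) :: 'k::field_char_0 Sym) =
    (\<Sum>w\<in>shuffles [1..<Suc i] (map ((+) i) v). L_set (i + m) (shifted_tops w))"
proof -
  let ?f = "\<lambda>T. L_set (i + m) ((\<lambda>d. d - 1) ` T) :: 'k Sym"
  let ?v = "map ((+) i) v"
  have "(\<Sum>w\<in>shuffles [1..<Suc i] ?v. L_set (i + m) (shifted_tops w)) =
      (\<Sum>A\<in>Pow (set ?v). of_nat (length [1..<Suc i] choose card A) * ?f (descent_tops ?v \<union> A))"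
    unfolding shifted_tops_def
    by (rule sum_shuffles_descent_tops) (use assms in \<open>auto simp: distinct_map simp del: upt_Suc\<close>)
  also have "\<dots> = (\<Sum>A\<in>Pow {0..<m}. of_nat (i choose card A) *
      L_set (i + m) ((+) i ` (shifted_tops v \<union> A)))"
  \<comment> \<open>The letters \<open>i + 1\<close> to \<open>i + m\<close> correspond to
    \<open>0\<close> to \<open>m - 1\<close>, so the shift is by \<open>Suc i\<close>; the
    \<open>d - 1\<close> in \<open>shifted_tops\<close> reduces it to the shift by
    \<open>i\<close>.\<close>
  proof (rule sum.reindex_bij_witness[of _ "(`) ((+) (Suc i))" "(`) (\<lambda>x. x - Suc i)"])
    fix A assume "A \<in> Pow (set ?v)"
    then have A: "A \<subseteq> {Suc i..i + m}" using assms by (auto simp: image_add_atLeastAtMost)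
    then have "A \<subseteq> {Suc i..}" by auto
    from iffD1[OF shift_image_eq_iff[OF this] refl, symmetric]
    show *: "(+) (Suc i) ` (\<lambda>x. x - Suc i) ` A = A" .
    show "(\<lambda>x. x - Suc i) ` A \<in> Pow {0..<m}" using A by fastforce
    define B where "B = (\<lambda>x. x - Suc i) ` A"
    have A_eq: "A = (+) (Suc i) ` B" using * by (simp add: B_def)
    have "card B = card A" unfolding A_eq by (rule card_image[symmetric]) simp
    moreover have "(+) i ` (shifted_tops v \<union> B) = (\<lambda>d. d - 1) ` (descent_tops ?v \<union> A)"
    proof -
      have "d \<ge> 1" if "d \<in> descent_tops v" for d using that descent_tops_subset assms by fastforce
      then have "(+) i ` (\<lambda>d. d - 1) ` descent_tops v = (\<lambda>d. d - 1) ` (+) i ` descent_tops v"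
        unfolding image_image by (intro image_cong) auto
      then show ?thesis
        by (simp add: image_Un shifted_tops_def descent_tops_map_add A_eq image_image)
    qed
    ultimately show "of_nat (i choose card ((\<lambda>x. x - Suc i) ` A)) *
        L_set (i + m) ((+) i ` (shifted_tops v \<union> (\<lambda>x. x - Suc i) ` A)) =
      of_nat (length [1..<Suc i] choose card A) * ?f (descent_tops ?v \<union> A)"
      unfolding B_def[symmetric] by (simp del: upt_Suc)
  next
    fix A assume "A \<in> Pow {0..<m}"
    then have A: "A \<subseteq> {0..<m}" by simp
    show "(\<lambda>x. x - Suc i) ` (+) (Suc i) ` A = A" by (simp add: image_image)
    have "(+) (Suc i) ` A \<subseteq> (+) (Suc i) ` {0..<m}" using A by (rule image_mono)
    also have "\<dots> = {Suc i..<Suc i + m}" by (subst image_add_atLeastLessThan) (simp add: add.commute)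
    also have "\<dots> = set ?v" using assms by (auto simp: image_add_atLeastAtMost)
    finally show "(+) (Suc i) ` A \<in> Pow (set ?v)" by simp
  qed
  also have "\<dots> = S i * L_set m (shifted_tops v)"
    by (rule S_mult_L_set[OF shifted_tops_subset[OF assms(2)], symmetric])
  finally show ?thesis by simp
qed

text \<open>The shuffles of \<open>1\<close> to \<open>i\<close> with the shifts of all
  \<open>v\<close> in \<open>words m E\<close> are the words whose inverse descents other than
  \<open>i\<close> form the shift of \<open>E\<close>. Whether \<open>i\<close> is one separates the
  two summands: without it \<open>i\<close> is added to the first part, with it \<open>i\<close> is
  prepended.\<close>

lemma S_mult_L_sum:
  assumes E: "E \<subseteq> {1..<m}" and "0 < i"
  shows "S i * (L_sum m E :: 'k::field_char_0 Sym) =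
    L_sum (i + m) ((+) i ` E) + (if m = 0 then 0 else L_sum (i + m) (insert i ((+) i ` E)))"
proof -
  define X where "X = {w. distinct w \<and> set w = {1..i + m} \<and> inverse_descents w - {i} = (+) i ` E}"
  have "X \<subseteq> permutations_of_set {1..i + m}" by (auto simp: X_def permutations_of_set_def)
  then have finX: "finite X" using finite_permutations_of_set finite_subset by blast
  \<comment> \<open>Erasing the letters up to \<open>i\<close> and lowering the others recovers
    \<open>v\<close>; the fibres on \<open>X\<close> are the shuffles.\<close>
  let ?g = "\<lambda>w. map (\<lambda>x. x - i) (filter (\<lambda>x. \<not> x \<le> i) w)"
  have g: "?g w \<in> words m E" if w: "w \<in> X" for w
  proof -
    have w: "distinct w" "set w = {1..i + m}" "inverse_descents w - {i} = (+) i ` E"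
      using w by (auto simp: X_def)
    have map_g: "map ((+) i) (?g w) = filter (\<lambda>x. \<not> x \<le> i) w"
    proof -
      have "map ((+) i) (?g w) = map (\<lambda>x. x) (filter (\<lambda>x. \<not> x \<le> i) w)"
        unfolding map_map by (intro map_cong) auto
      then show ?thesis by simp
    qed
    have "distinct (map ((+) i) (?g w))" unfolding map_g using w(1) by simp
    then have "distinct (?g w)" unfolding distinct_map by simp
    moreover have "set (?g w) = {1..m}"
    proof -
      have "(+) i ` set (?g w) = set (filter (\<lambda>x. \<not> x \<le> i) w)" using map_g by (metis set_map)
      also have "\<dots> = {i + 1..i + m}" using w(2) by auto
      also have "\<dots> = (+) i ` {1..m}" by (simp add: image_add_atLeastAtMost)
      finally show ?thesis by (subst (asm) inj_image_eq_iff) simp_all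
    qed
    moreover have "inverse_descents (?g w) = E"
    proof -
      have *: "inverse_descents (filter (\<lambda>x. \<not> x \<le> i) w) \<subseteq> {i<..}"
        using inverse_descents_letters(1) by fastforce
      have **: "{i<..} \<inter> inverse_descents (filter (\<lambda>x. x \<le> i) w) = {}"
        using inverse_descents_letters(1) by fastforce
      have "(+) i ` E = {i<..} \<inter> (+) i ` E" using E by auto
      also have "\<dots> = {i<..} \<inter> (inverse_descents w - {i})" using w by simp
      also have "\<dots> = inverse_descents (filter (\<lambda>x. \<not> x \<le> i) w)"
        unfolding inverse_descents_split using * ** by blast
      also have "\<dots> = (+) i ` inverse_descents (?g w)"
        using inverse_descents_map_add[of i "?g w"] unfolding map_g .
      finally show ?thesis by (subst (asm) inj_image_eq_iff) simp_all
    qed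
    ultimately show ?thesis by (simp add: words_iff)
  qed
  have fibre: "{w \<in> X. ?g w = v} = shuffles [1..<Suc i] (map ((+) i) v)" if "v \<in> words m E" for v
    using words_shuffle[OF E that, of i] by (simp add: X_def conj_assoc del: upt_Suc)
  have "S i * (L_sum m E :: 'k Sym) = (\<Sum>v\<in>words m E. S i * L_set m (shifted_tops v))"
    by (simp add: L_sum_def sum_distrib_left)
  also have "\<dots> = (\<Sum>v\<in>words m E. \<Sum>w | w \<in> X \<and> ?g w = v. L_set (i + m) (shifted_tops w))"
  proof (rule sum.cong[OF refl])
    fix v assume v: "v \<in> words m E"
    then have "distinct v" "set v = {1..m}" by (auto simp: words_iff)
    from S_mult_L_set_shifted_tops[OF this, of i, where 'k = 'k] fibre[OF v]
    show "S i * (L_set m (shifted_tops v) :: 'k Sym) =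
      (\<Sum>w | w \<in> X \<and> ?g w = v. L_set (i + m) (shifted_tops w))" by metis
  qed
  also have "\<dots> = (\<Sum>w\<in>X. L_set (i + m) (shifted_tops w))"
    using finX g finite_words by (intro sum.group) auto
  also have "X = words (i + m) ((+) i ` E) \<union> (if m = 0 then {} else words (i + m) (insert i ((+) i ` E)))"
  proof -
    have i: "i \<notin> (+) i ` E" using E by auto
    \<comment> \<open>For \<open>m = 0\<close> there is no letter \<open>Suc i\<close>, so
      \<open>i\<close> cannot be an inverse descent.\<close>
    have m0: "words (i + m) (insert i ((+) i ` E)) = {}" if "m = 0"
      using inverse_descents_subset[of _ i] that by (force simp: words_iff)
    have *: "A - {i} = (+) i ` E \<longleftrightarrow> A = (+) i ` E \<or> A = insert i ((+) i ` E)" for A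
      using i by auto
    have "X = words (i + m) ((+) i ` E) \<union> words (i + m) (insert i ((+) i ` E))"
      unfolding X_def * by (auto simp: words_iff)
    then show ?thesis using m0 by simp
  qed
  also have "(\<Sum>w\<in>\<dots>. L_set (i + m) (shifted_tops w) :: 'k Sym) = L_sum (i + m) ((+) i ` E) +
      (if m = 0 then 0 else L_sum (i + m) (insert i ((+) i ` E)))"
  proof -
    have "i \<notin> (+) i ` E" using E by auto
    then have "(+) i ` E \<noteq> insert i ((+) i ` E)" by blast
    then have "words (i + m) ((+) i ` E) \<inter> words (i + m) (insert i ((+) i ` E)) = {}"
      by (metis words_iff disjoint_iff)
    then show ?thesis by (simp add: L_sum_def sum.union_disjoint finite_words)
  qed
  finally show ?thesis .
qed

subsection \<open>Ribbons\<close>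

text \<open>Blocks are nonempty. The bound makes \<open>length I - length J\<close> in
  \<open>ribbon\<close> an honest difference.\<close>

lemma coarser_eq_length_le: "coarser_eq J I \<Longrightarrow> length J \<le> length I"
proof -
  have "length B \<le> length (concat B)" if "[] \<notin> set B" for B :: "nat list list"
    using that
  proof (induction B)
    case (Cons b B)
    then have "1 \<le> length b" by (cases b) auto
    then show ?case using Cons by simp
  qed simp
  then show "coarser_eq J I \<Longrightarrow> length J \<le> length I" by (auto simp: coarser_eq_def)
qed

lemma coarser_eq_Nil_iff: "coarser_eq J [] \<longleftrightarrow> J = []"
  using coarser_eq_length_le[of J "[]"] by (auto simp: coarser_eq_def intro: exI[of _ "[]"])

lemma coarser_eq_single_iff: "coarser_eq J [i] \<longleftrightarrow> J = [i]"
proof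
  assume "coarser_eq J [i]"
  then obtain B where B: "[] \<notin> set B" "concat B = [i]" "J = map sum_list B"
    by (auto simp: coarser_eq_def)
  then obtain b B' where b: "B = b # B'" by (cases B) auto
  moreover have "concat B' = []" "b = [i]" using B b by (auto simp: append_eq_Cons_conv)
  moreover have "B' = []" using B b \<open>concat B' = []\<close> by (cases B') auto
  ultimately show "J = [i]" using B by simp
qed (auto simp: coarser_eq_def intro: exI[of _ "[[i]]"])

text \<open>The first block is \<open>[i]\<close> alone or also contains \<open>k\<close>; in the
  latter case \<open>i\<close> and \<open>k\<close> can be merged beforehand.\<close>

lemma coarser_eq_Cons_Cons_iff:
  "coarser_eq J (i # k # I) \<longleftrightarrow>
    (\<exists>J'. J = i # J' \<and> coarser_eq J' (k # I)) \<or> coarser_eq J ((i + k) # I)"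
proof
  assume "coarser_eq J (i # k # I)"
  then obtain B where B: "[] \<notin> set B" "concat B = i # k # I" "J = map sum_list B"
    by (auto simp: coarser_eq_def)
  then obtain b B' where b: "B = (i # b) # B'"
    by (cases B) (auto simp: append_eq_Cons_conv)
  show "(\<exists>J'. J = i # J' \<and> coarser_eq J' (k # I)) \<or> coarser_eq J ((i + k) # I)"
  proof (cases b)
    case Nil
    then have "J = i # map sum_list B'" "coarser_eq (map sum_list B') (k # I)"
      using B b by (auto simp: coarser_eq_def)
    then show ?thesis by blast
  next
    case (Cons l b')
    then have "coarser_eq J ((i + k) # I)"
      using B b by (auto simp: coarser_eq_def intro!: exI[of _ "((i + k) # b') # B'"])
    then show ?thesis by blast
  qed
next
  assume "(\<exists>J'. J = i # J' \<and> coarser_eq J' (k # I)) \<or> coarser_eq J ((i + k) # I)"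
  then show "coarser_eq J (i # k # I)"
  proof (elim disjE exE conjE)
    fix J' assume "J = i # J'" "coarser_eq J' (k # I)"
    then obtain B where "[] \<notin> set B" "concat B = k # I" "J = i # map sum_list B"
      by (auto simp: coarser_eq_def)
    then show ?thesis by (auto simp: coarser_eq_def intro!: exI[of _ "[i] # B"])
  next
    assume "coarser_eq J ((i + k) # I)"
    then obtain B where B: "[] \<notin> set B" "concat B = (i + k) # I" "J = map sum_list B"
      by (auto simp: coarser_eq_def)
    then obtain b B' where "B = ((i + k) # b) # B'"
      by (cases B) (auto simp: append_eq_Cons_conv)
    then show ?thesis using B
      by (auto simp: coarser_eq_def intro!: exI[of _ "(i # k # b) # B'"])
  qed
qed

lemma ribbon_Nil: "ribbon [] = (1 :: 'k::field_char_0 Sym)"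
proof -
  have "{J \<in> compositions 0. coarser_eq J []} = {[]}"
    by (auto simp: coarser_eq_Nil_iff compositions_def)
  then show ?thesis by (simp add: ribbon_def S_comp_def)
qed

lemma ribbon_single:
  assumes "0 < i"
  shows "ribbon [i] = (S i :: 'k::field_char_0 Sym)"
proof -
  have "{J \<in> compositions i. coarser_eq J [i]} = {[i]}"
    using assms by (auto simp: coarser_eq_single_iff compositions_def)
  then show ?thesis by (simp add: ribbon_def S_comp_def)
qed

text \<open>The coarser compositions split by whether \<open>i\<close> stays alone. Merging it with
  \<open>k\<close> lowers the length of the composition by one, hence the minus sign.\<close>

lemma ribbon_Cons_Cons:
  assumes "0 < i" "0 < k"
  shows "ribbon (i # k # I) = S i * (ribbon (k # I) :: 'k::field_char_0 Sym) - ribbon ((i + k) # I)"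
proof -
  let ?m = "k + sum_list I"
  let ?A = "{J \<in> compositions ?m. coarser_eq J (k # I)}"
  let ?B = "{J \<in> compositions (i + ?m). coarser_eq J ((i + k) # I)}"
  let ?t = "\<lambda>l J. (-1) ^ (l - length J) * (S_comp J :: 'k Sym)"
  have split: "{J \<in> compositions (i + ?m). coarser_eq J (i # k # I)} = (#) i ` ?A \<union> ?B"
  proof -
    have "i # J \<in> compositions (i + ?m) \<longleftrightarrow> J \<in> compositions ?m" for J
      using assms by (simp add: compositions_def)
    then have "J \<in> {J \<in> compositions (i + ?m). coarser_eq J (i # k # I)} \<longleftrightarrow> J \<in> (#) i ` ?A \<union> ?B" for J
      unfolding mem_Collect_eq Un_iff image_iff bex_simps coarser_eq_Cons_Cons_iff[of J i k I] by metis
    then show ?thesis by (rule set_eqI)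
  qed
  \<comment> \<open>In the second kind the first part is at least \<open>i + k\<close>, which
    exceeds \<open>i\<close>.\<close>
  have disj: "(#) i ` ?A \<inter> ?B = {}"
  proof -
    have False if J: "coarser_eq (i # J) ((i + k) # I)" for J
    proof -
      obtain B where B: "[] \<notin> set B" "concat B = (i + k) # I" "i # J = map sum_list B"
        using J[unfolded coarser_eq_def] by (elim exE conjE)
      then obtain b B' where "B = ((i + k) # b) # B'"
        by (cases B) (auto simp: append_eq_Cons_conv)
      then show False using B assms by auto
    qed
    then show ?thesis by auto
  qed
  have fin: "finite ?A" "finite ?B" using finite_compositions by auto
  have "sum_list (i # k # I) = i + ?m" "length (i # k # I) = length I + 2" by simp_all
  then have "ribbon (i # k # I) = (\<Sum>J\<in>(#) i ` ?A \<union> ?B. ?t (length I + 2) J)"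
    by (simp only: ribbon_def split)
  also have "\<dots> = (\<Sum>J\<in>(#) i ` ?A. ?t (length I + 2) J) + (\<Sum>J\<in>?B. ?t (length I + 2) J)"
    using fin disj by (intro sum.union_disjoint) auto
  also have "(\<Sum>J\<in>(#) i ` ?A. ?t (length I + 2) J) = (\<Sum>J\<in>?A. S i * ?t (length I + 1) J)"
  proof -
    have "?t (length I + 2) (i # J) = S i * ?t (length I + 1) J" for J
    proof -
      have "S i * ((-1) ^ r * x) = (-1) ^ r * (S i * x)" for r and x :: "'k Sym"
        by (cases "even r") simp_all
      then show ?thesis by (simp add: S_comp_def)
    qed
    then show ?thesis by (simp add: sum.reindex)
  qed
  also have "\<dots> = S i * ribbon (k # I)" by (simp add: ribbon_def sum_distrib_left)
  also have "(\<Sum>J\<in>?B. ?t (length I + 2) J) = (\<Sum>J\<in>?B. - ?t (length I + 1) J)"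
  proof (rule sum.cong[OF refl])
    fix J assume "J \<in> ?B"
    then have "length J \<le> length I + 1" using coarser_eq_length_le[of J "(i + k) # I"] by simp
    then have "length I + 2 - length J = Suc (length I + 1 - length J)" by simp
    then show "?t (length I + 2) J = - ?t (length I + 1) J" by (simp only: power_Suc) simp
  qed
  also have "\<dots> = - ribbon ((i + k) # I)" by (simp add: ribbon_def sum_negf add.assoc)
  finally show ?thesis by simp
qed

section \<open>Identification of the ribbons with sums over words\<close>

lemma L_sum_0: "L_sum 0 {} = (1 :: 'k::field_char_0 Sym)"
proof -
  have "words 0 {} = {[]}" by (auto simp: words_iff inverse_descents_def)
  moreover have "comp_of_set 0 {} = []"
    using comp_of_set_proper_partial_sums[of "[]" 0]
    by (simp add: compositions_def proper_partial_sums_Nil)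
  moreover have "{E. E \<subseteq> {1..<0}} = {{} :: nat set}" by auto
  ultimately show ?thesis
    by (simp add: L_sum_def L_set_def shifted_tops_def Psi_set_def Psi_Nil)
qed

text \<open>\<open>S_mult_L_sum\<close> and \<open>ribbon_Cons_Cons\<close> give both sides the same
  recursion. The induction is on the length because \<open>(i + k) # K\<close> is shorter than
  \<open>I\<close> but not a tail of it.\<close>

lemma ribbon_eq_L_sum:
  assumes "I \<in> compositions n"
  shows "ribbon I = (L_sum n (proper_partial_sums I) :: 'k::field_char_0 Sym)"
  using assms
proof (induction I arbitrary: n rule: length_induct)
  case (1 I)
  have n: "n = sum_list I" and pos: "0 \<notin> set I" using "1.prems" by (auto simp: compositions_def)
  have comp: "J \<in> compositions (sum_list J)" if "0 \<notin> set J" for J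
    using that by (simp add: compositions_def)
  consider "I = []" | i where "I = [i]" | i k K where "I = i # k # K"
    by (metis list.exhaust)
  then show ?case
  proof cases
    case 1
    then show ?thesis using n by (simp add: ribbon_Nil L_sum_0 proper_partial_sums_Nil)
  next
    case (2 i)
    then show ?thesis using n pos S_mult_L_sum[of "{}" 0 i, where 'k = 'k]
      by (simp add: ribbon_single L_sum_0 proper_partial_sums_Cons)
  next
    case (3 i k K)
    let ?E = "proper_partial_sums (k # K)"
    have ik: "0 < i" "0 < k" "0 \<notin> set K" using pos 3 by auto
    have c1: "k # K \<in> compositions (k + sum_list K)" using comp[of "k # K"] ik by simp
    have c2: "(i + k) # K \<in> compositions n" using ik by (simp add: compositions_def n 3)
    have E: "?E \<subseteq> {1..<k + sum_list K}" using proper_partial_sums_subset[OF c1] .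
    have "ribbon (k # K) = (L_sum (k + sum_list K) ?E :: 'k Sym)"
      using "1.IH" c1 3 by simp
    moreover have "ribbon ((i + k) # K) = (L_sum n ((+) i ` ?E) :: 'k Sym)"
      using "1.IH" c2 3 by (simp flip: proper_partial_sums_add_Cons)
    moreover have "proper_partial_sums I = insert i ((+) i ` ?E)"
      unfolding 3 by (subst proper_partial_sums_Cons) simp
    ultimately show ?thesis
      using S_mult_L_sum[OF E ik(1), where 'k = 'k] ik n
      by (simp add: 3 ribbon_Cons_Cons)
  qed
qed

section \<open>Translation from permutations to words\<close>

lemma descent_tops_nth: "descent_tops w = {w ! k | k. Suc k < length w \<and> w ! k > w ! Suc k}"
proof (induction w rule: descent_tops.induct)
  case (3 x y ys)
  let ?P = "\<lambda>w k. Suc k < length w \<and> w ! k > w ! Suc k"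
  have "z \<in> {(x # y # ys) ! k | k. ?P (x # y # ys) k} \<longleftrightarrow>
      (x > y \<and> z = x) \<or> z \<in> {(y # ys) ! k | k. ?P (y # ys) k}" for z
  proof
    assume "z \<in> {(x # y # ys) ! k | k. ?P (x # y # ys) k}"
    then obtain k where k: "?P (x # y # ys) k" "z = (x # y # ys) ! k" by blast
    then show "(x > y \<and> z = x) \<or> z \<in> {(y # ys) ! k | k. ?P (y # ys) k}"
      by (cases k) auto
  next
    assume "(x > y \<and> z = x) \<or> z \<in> {(y # ys) ! k | k. ?P (y # ys) k}"
    then show "z \<in> {(x # y # ys) ! k | k. ?P (x # y # ys) k}"
    proof (elim disjE)
      assume "x > y \<and> z = x"
      then have "?P (x # y # ys) 0" "z = (x # y # ys) ! 0" by auto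
      then show ?thesis by blast
    next
      assume "z \<in> {(y # ys) ! k | k. ?P (y # ys) k}"
      then obtain k where "?P (y # ys) k" "z = (y # ys) ! k" by blast
      then have "?P (x # y # ys) (Suc k)" "z = (x # y # ys) ! Suc k" by auto
      then show ?thesis by blast
    qed
  qed
  then show ?case using 3 by (auto split: if_splits)
qed auto

lemma GDes_eq_descent_tops: "GDes n \<sigma> = descent_tops (map \<sigma> [1..<Suc n])"
proof (intro equalityI subsetI)
  fix x assume "x \<in> GDes n \<sigma>"
  then obtain j where j: "1 \<le> j" "j < n" "\<sigma> j > \<sigma> (j + 1)" "x = \<sigma> j"
    by (auto simp: GDes_def)
  \<comment> \<open>Positions count from 1, list indices from 0.\<close>
  then show "x \<in> descent_tops (map \<sigma> [1..<Suc n])"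
    unfolding descent_tops_nth
    by (auto simp del: upt_Suc intro!: exI[of _ "j - 1"])
next
  fix x assume "x \<in> descent_tops (map \<sigma> [1..<Suc n])"
  then obtain k where "Suc k < n" "\<sigma> (Suc k) > \<sigma> (Suc (Suc k))" "x = \<sigma> (Suc k)"
    unfolding descent_tops_nth by (auto simp del: upt_Suc)
  then show "x \<in> GDes n \<sigma>" unfolding GDes_def by (auto intro!: exI[of _ "Suc k"])
qed

lemma filter_two_upt:
  assumes "p < q" "a \<le> p" "q < b"
  shows "filter (\<lambda>j. j = p \<or> j = q) [a..<b] = [p, q]"
  by (rule sorted_distinct_set_unique) (use assms in \<open>auto intro: sorted_wrt_filter\<close>)

text \<open>\<open>inv \<sigma> d\<close> is the position of the letter \<open>d\<close>. The
  filtered word lists \<open>d\<close> and \<open>Suc d\<close> by position, so it is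
  \<open>[Suc d, d]\<close> exactly when \<open>Suc d\<close> stands first.\<close>

lemma inverse_descents_map_permutes:
  assumes \<sigma>: "\<sigma> permutes {1..n}"
  shows "inverse_descents (map \<sigma> [1..<Suc n]) = {i. 1 \<le> i \<and> i < n \<and> inv \<sigma> i > inv \<sigma> (i + 1)}"
proof -
  let ?w = "map \<sigma> [1..<Suc n]"
  have "set [1..<Suc n] = {1..n}" by auto
  then have set: "set ?w = {1..n}" using permutes_image[OF \<sigma>] by (metis set_map)
  have "d \<in> inverse_descents ?w \<longleftrightarrow> inv \<sigma> d > inv \<sigma> (d + 1)" if d: "1 \<le> d" "d < n" for d
  proof -
    define p where "p = inv \<sigma> d"
    define q where "q = inv \<sigma> (Suc d)"
    have "p \<in> {1..n}" "q \<in> {1..n}"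
      unfolding p_def q_def using permutes_in_image[OF permutes_inv[OF \<sigma>]] d by auto
    then have pq: "1 \<le> p" "p < Suc n" "1 \<le> q" "q < Suc n" by auto
    have \<sigma>pq: "\<sigma> j = d \<longleftrightarrow> j = p" "\<sigma> j = Suc d \<longleftrightarrow> j = q" for j
      unfolding p_def q_def using permutes_inverses[OF \<sigma>] by metis+
    then have "p \<noteq> q" by (metis n_not_Suc_n)
    have filter: "filter (\<lambda>x. x = d \<or> x = Suc d) ?w = map \<sigma> (filter (\<lambda>j. j = p \<or> j = q) [1..<Suc n])"
      by (simp add: filter_map o_def \<sigma>pq del: upt_Suc)
    show ?thesis
    proof (cases "p < q")
      case True
      then have "filter (\<lambda>x. x = d \<or> x = Suc d) ?w = [d, Suc d]"
        unfolding filter using filter_two_upt[of p q 1 "Suc n"] pq \<sigma>pq by (simp del: upt_Suc)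
      then show ?thesis using True by (simp add: inverse_descents_def p_def q_def del: upt_Suc)
    next
      case False
      then have "q < p" using \<open>p \<noteq> q\<close> by simp
      moreover have "(\<lambda>j. j = p \<or> j = q) = (\<lambda>j. j = q \<or> j = p)" by auto
      ultimately have "filter (\<lambda>x. x = d \<or> x = Suc d) ?w = [Suc d, d]"
        unfolding filter using filter_two_upt[of q p 1 "Suc n"] pq \<sigma>pq by (simp del: upt_Suc)
      then show ?thesis using \<open>q < p\<close> by (simp add: inverse_descents_def p_def q_def del: upt_Suc)
    qed
  qed
  then show ?thesis using inverse_descents_subset[OF set] by fastforce
qed

lemma bij_betw_permutes_words:
  "bij_betw (\<lambda>\<sigma>. map \<sigma> [1..<Suc n]) {\<sigma>. \<sigma> permutes {1..n}} (permutations_of_set {1..n})"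
proof (rule bij_betw_imageI)
  have set: "set [1..<Suc n] = {1..n}" by auto
  show "inj_on (\<lambda>\<sigma>. map \<sigma> [1..<Suc n]) {\<sigma>. \<sigma> permutes {1..n}}"
  proof (rule inj_onI)
    fix \<sigma> \<tau> :: "nat \<Rightarrow> nat"
    assume "\<sigma> \<in> {\<sigma>. \<sigma> permutes {1..n}}" "\<tau> \<in> {\<sigma>. \<sigma> permutes {1..n}}"
      and eq: "map \<sigma> [1..<Suc n] = map \<tau> [1..<Suc n]"
    then have "\<sigma> x = \<tau> x" if "x \<notin> {1..n}" for x using that by (auto simp: permutes_def)
    moreover have "\<sigma> x = \<tau> x" if "x \<in> {1..n}" for x using eq that set by (metis map_eq_conv)
    ultimately show "\<sigma> = \<tau>" by blast
  qed
  show "(\<lambda>\<sigma>. map \<sigma> [1..<Suc n]) ` {\<sigma>. \<sigma> permutes {1..n}} = permutations_of_set {1..n}"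
  proof (intro equalityI subsetI)
    fix w assume "w \<in> (\<lambda>\<sigma>. map \<sigma> [1..<Suc n]) ` {\<sigma>. \<sigma> permutes {1..n}}"
    then obtain \<sigma> where \<sigma>: "\<sigma> permutes {1..n}" "w = map \<sigma> [1..<Suc n]" by auto
    have "set w = {1..n}" unfolding \<sigma>(2) set_map set using permutes_image[OF \<sigma>(1)] .
    moreover have "distinct w"
      unfolding \<sigma>(2) distinct_map set using permutes_inj_on[OF \<sigma>(1)] by simp
    ultimately show "w \<in> permutations_of_set {1..n}" by (simp add: permutations_of_set_def)
  next
    fix w :: "nat list" assume "w \<in> permutations_of_set {1..n}"
    then have w: "set w = {1..n}" "distinct w" by (auto simp: permutations_of_set_def)
    then have len: "length w = n" by (metis card_atLeastAtMost diff_Suc_1 distinct_card)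
    \<comment> \<open>The identity outside \<open>{1..n}\<close> is what \<open>permutes\<close>
      demands.\<close>
    define \<sigma> where "\<sigma> = (\<lambda>x. if x \<in> {1..n} then w ! (x - 1) else x)"
    have map: "map \<sigma> [1..<Suc n] = w"
      by (rule nth_equalityI) (auto simp: len \<sigma>_def simp del: upt_Suc)
    have "bij_betw \<sigma> {1..n} {1..n}"
    proof (rule bij_betw_imageI)
      show "inj_on \<sigma> {1..n}" using w(2) map set by (metis distinct_map)
      show "\<sigma> ` {1..n} = {1..n}" using w(1) map set by (metis set_map)
    qed
    then have "\<sigma> permutes {1..n}" by (rule bij_imp_permutes) (simp only: \<sigma>_def if_False)
    then show "w \<in> (\<lambda>\<sigma>. map \<sigma> [1..<Suc n]) ` {\<sigma>. \<sigma> permutes {1..n}}" using map by blast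
  qed
qed

theorem theorem5p1:
  fixes n :: nat and I :: "nat list"
  assumes "I \<in> compositions n"
  shows "(ribbon I :: 'k::field_char_0 Sym) = (\<Sum>J\<in>compositions n. of_nat (G n I J) * L J)"
proof -
  let ?w = "\<lambda>\<sigma>. map \<sigma> [1..<Suc n]"
  define P where "P = {\<sigma>. \<sigma> permutes {1..n} \<and> D n (inv \<sigma>) = I}"
  have finP: "finite P"
    by (rule finite_subset[of _ "{\<sigma>. \<sigma> permutes {1..n}}"]) (auto simp: P_def finite_permutations)
  have w: "?w \<sigma> \<in> permutations_of_set {1..n}" if "\<sigma> permutes {1..n}" for \<sigma>
    using bij_betwE[OF bij_betw_permutes_words[of n]] that by auto
  have tops: "(\<lambda>d. d - 1) ` GDes n \<sigma> = shifted_tops (?w \<sigma>)" for \<sigma>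
    unfolding shifted_tops_def GDes_eq_descent_tops ..
  have tops_subset: "shifted_tops (?w \<sigma>) \<subseteq> {1..<n}" if "\<sigma> permutes {1..n}" for \<sigma>
    using shifted_tops_subset w[OF that] permutations_of_setD by blast
  have GC: "GC n \<sigma> \<in> compositions n" "L (GC n \<sigma>) = (L_set n (shifted_tops (?w \<sigma>)) :: 'k Sym)"
    if "\<sigma> permutes {1..n}" for \<sigma>
    using comp_of_set[OF tops_subset[OF that]]
      L_eq_L_set[OF comp_of_set(1)[OF tops_subset[OF that]], where 'k = 'k]
    unfolding GC_def tops by (simp_all del: upt_Suc)
  have D_iff: "D n (inv \<sigma>) = I \<longleftrightarrow> inverse_descents (?w \<sigma>) = proper_partial_sums I"
    if "\<sigma> permutes {1..n}" for \<sigma>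
    unfolding D_def inverse_descents_map_permutes[OF that]
    by (rule comp_of_set_eq_iff[OF assms]) auto
  \<comment> \<open>The word map turns the condition on \<open>D n (inv \<sigma>)\<close> into the
    one defining \<open>words\<close>.\<close>
  have "bij_betw ?w {\<sigma> \<in> {\<sigma>. \<sigma> permutes {1..n}}. D n (inv \<sigma>) = I} (words n (proper_partial_sums I))"
    unfolding words_def by (rule bij_betw_Collect[OF bij_betw_permutes_words]) (use D_iff in blast)
  then have "bij_betw ?w P (words n (proper_partial_sums I))" by (simp add: P_def del: upt_Suc)
  then have "(L_sum n (proper_partial_sums I) :: 'k Sym) = (\<Sum>\<sigma>\<in>P. L_set n (shifted_tops (?w \<sigma>)))"
    unfolding L_sum_def by (rule sum.reindex_bij_betw[symmetric])
  also have "\<dots> = (\<Sum>\<sigma>\<in>P. L (GC n \<sigma>))" using GC(2) by (simp add: P_def del: upt_Suc)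
  \<comment> \<open>Grouped by the value \<open>J\<close> of \<open>GC n\<close>, each fibre has
    \<open>G n I J\<close> elements and a constant summand.\<close>
  also have "\<dots> = (\<Sum>J\<in>compositions n. \<Sum>\<sigma> | \<sigma> \<in> P \<and> GC n \<sigma> = J. L (GC n \<sigma>))"
    using finP finite_compositions GC(1)
    by (intro sum.group[symmetric]) (auto simp: P_def)
  also have "\<dots> = (\<Sum>J\<in>compositions n. of_nat (G n I J) * L J)"
  proof (rule sum.cong[OF refl])
    fix J
    have "(\<Sum>\<sigma> | \<sigma> \<in> P \<and> GC n \<sigma> = J. L (GC n \<sigma>)) = (\<Sum>\<sigma> | \<sigma> \<in> P \<and> GC n \<sigma> = J. L J :: 'k Sym)"
      by (rule sum.cong) auto
    moreover have "{\<sigma>. \<sigma> permutes {1..n} \<and> D n (inv \<sigma>) = I \<and> GC n \<sigma> = J} = {\<sigma>. \<sigma> \<in> P \<and> GC n \<sigma> = J}"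
      unfolding P_def by blast
    ultimately show "(\<Sum>\<sigma> | \<sigma> \<in> P \<and> GC n \<sigma> = J. L (GC n \<sigma>)) = of_nat (G n I J) * (L J :: 'k Sym)"
      by (simp only: G_def sum_constant)
  qed
  finally show ?thesis unfolding ribbon_eq_L_sum[OF assms] .
qed

end
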